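(* Let $k\in\mathbb{N}$. Then $NC^k(\mathbb{R})\subsetneq C^k(\mathbb{R})$. Specifically, fix $\eta\in C_c^\infty(\mathbb{R})$ such that $\eta\equiv1$ on $\left[-\frac12-\frac1e,\frac1e+\frac12\right]$ and $\operatorname{supp}\eta\subseteq\left[-\frac35-\frac1e,\frac1e+\frac35\right]$, and define $$h(x):=1_{(0,1)}(|x|)\,\frac{\eta(x)\,|x|}{\sqrt{\log\big|\log|x|-1\big|}},\qquad x\in\mathbb{R}$$ (so $h(x)=0$ when $x=0$ or $|x|\ge1$). If $f_k(x):=x^{k-1}h(x)$ for all $x\in\mathbb{R}$, then $f_k\in C^k(\mathbb{R})\setminus NC^k(\mathbb{R})$.
   Context: $\mathbb{N}=\{1,2,\dots\}$; $C^k(\mathbb{R})$ is the space of $k$-times continuously differentiable functions $\mathbb{R}\to\mathbb{C}$; $\mathbb{C}[\lambda]$ is the set of complex polynomials in one real variable. Divided differences. $f^{[0]}:=f$ and, recursively, for distinct $\lambda_1,\dots,\lambda_{j+1}\in\mathbb{R}$, $f^{[j]}(\lambda_1,\dots,\lambda_{j+1}):=\frac{f^{[j-1]}(\lambda_1,\dots,\lambda_j)-f^{[j-1]}(\lambda_1,\dots,\lambda_{j-1},\lambda_{j+1})}{\lambda_j-\lambda_{j+1}}$. If $f\in C^j(\mathbb{R})$, then $f^{[j]}$ extends uniquely to a continuous function on $\mathbb{R}^{j+1}$, also denoted $f^{[j]}$. Integral projective tensor products. For a Polish space $\Omega$ with Borel $\sigma$-algebra $\mathcal{B}_\Omega$,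 $\ell^\infty(\Omega,\mathcal{B}_\Omega)$ is the space of bounded Borel functions $\Omega\to\mathbb{C}$, and $\|\varphi\|_{\ell^\infty(\Omega)}=\sup_\Omega|\varphi|$. Let $\Omega_1,\dots,\Omega_m$ be Polish spaces and $\Omega=\Omega_1\times\cdots\times\Omega_m$. An $\ell^\infty$-integral projective decomposition (IPD) of $\varphi\colon\Omega\to\mathbb{C}$ is a tuple $(\Sigma,\rho,\varphi_1,\dots,\varphi_m)$ where $(\Sigma,\mathscr{H},\rho)$ is a $\sigma$-finite measure space, each $\varphi_j\colon\Omega_j\times\Sigma\to\mathbb{C}$ is product measurable with $\varphi_j(\cdot,\sigma)\in\ell^\infty(\Omega_j,\mathcal{B}_{\Omega_j})$ for all $\sigma$, $\int_\Sigma\prod_{j=1}^m\|\varphi_j(\cdot,\sigma)\|_{\ell^\infty(\Omega_j)}\,\rho(d\sigma)<\infty$ (integral with respect to the completion of $\rho$), and $\varphi(\omega_1,\dots,\omega_m)=\int_\Sigma\varphi_1(\omega_1,\sigma)\cdots\varphi_m(\omega_m,\sigma)\,\rho(d\sigma)$ for all $(\omega_1,\dots,\omega_m)\in\Omega$. The norm $\|\varphi\|_{\ell^\infty(\Omega_1,\mathcal{B}_{\Omega_1})\hat\otimes_i\cdots\hat\otimes_i\ell^\infty(\Omega_m,\mathcal{B}_{\Omega_m})}$ is the infimum of $\int_\Sigma\prod_{j}\|\varphi_j(\cdot,\sigma)\|_{\ell^\infty(\Omega_j)}\,\rho(d\sigma)$ over all $\ell^\infty$-IPDs of $\varphi$ ($\inf\emptyset=\infty$),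 and $\ell^\infty(\Omega_1,\mathcal{B}_{\Omega_1})\hat\otimes_i\cdots\hat\otimes_i\ell^\infty(\Omega_m,\mathcal{B}_{\Omega_m})$ is the space of $\varphi\in\ell^\infty(\Omega,\mathcal{B}_\Omega)$ for which it is finite. When all factors are equal, this is written as an $m$-th power $(\cdot)^{\hat\otimes_i m}$. Noncommutative $C^k$ functions. $NC^k(\mathbb{R})$ is the set of $f\in C^k(\mathbb{R})$ for which there is a sequence $(q_n)_{n\in\mathbb{N}}$ in $\mathbb{C}[\lambda]$ such that for all $r>0$ and $j\in\{0,\dots,k\}$, $q_n^{[j]}|_{[-r,r]^{j+1}}\to f^{[j]}|_{[-r,r]^{j+1}}$ in $\ell^\infty([-r,r],\mathcal{B}_{[-r,r]})^{\hat\otimes_i(j+1)}$ as $n\to\infty$. *)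

theory Defs
  imports "HOL-Analysis.Analysis" "HOL-Computational_Algebra.Polynomial"
begin

primrec Ck :: "nat \<Rightarrow> (real \<Rightarrow> complex) set" where
  "Ck 0 = {f. continuous_on UNIV f}"
| "Ck (Suc k) = {f. \<exists>f'. (\<forall>x. (f has_vector_derivative f' x) (at x)) \<and> f' \<in> Ck k}"

definition Cc_infinity :: "(real \<Rightarrow> complex) set" where
  "Cc_infinity = {f. (\<forall>k. f \<in> Ck k) \<and> compact (closure {x. f x \<noteq> 0})}"


text \<open>
  A point of \<open>\<real>\<^sup>j\<^sup>+\<^sup>1\<close> is an extensional function on \<open>{..j}\<close>, so the arguments
  \<open>\<lambda>\<^sub>1, \<dots>, \<lambda>\<^sub>j\<^sub>+\<^sub>1\<close> are \<open>l 0, \<dots>, l j\<close>. The value \<open>divdiff f j l\<close>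
  depends only on these, and is meaningful when they are distinct.
\<close>

primrec divdiff :: "(real \<Rightarrow> complex) \<Rightarrow> nat \<Rightarrow> (nat \<Rightarrow> real) \<Rightarrow> complex" where
  "divdiff f 0 l = f (l 0)"
| "divdiff f (Suc j) l =
     (divdiff f j l - divdiff f j (l(j := l (Suc j)))) / of_real (l j - l (Suc j))"

text \<open>
  The continuous extension to all of \<open>\<real>\<^sup>j\<^sup>+\<^sup>1\<close>. Continuity refers to the product topology on
  \<open>nat \<Rightarrow> real\<close>, which induces the usual topology of \<open>\<real>\<^sup>j\<^sup>+\<^sup>1\<close> on the extensional functions.
  It is unique because tuples with distinct entries are dense (extensionality fixes the values of
  the HOL function outside its domain), and it exists for \<open>f \<in> Ck j\<close>.
\<close>

definition divdiff_ext :: "(real \<Rightarrow> complex) \<Rightarrow> nat \<Rightarrow> (nat \<Rightarrow> real) \<Rightarrow> complex" where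
  "divdiff_ext f j =
     (THE g. g \<in> extensional ({..j} \<rightarrow>\<^sub>E UNIV) \<and>
             continuous_on ({..j} \<rightarrow>\<^sub>E UNIV) g \<and>
             (\<forall>l \<in> {..j} \<rightarrow>\<^sub>E UNIV. inj_on l {..j} \<longrightarrow> g l = divdiff f j l))"


definition linf :: "'a measure \<Rightarrow> ('a \<Rightarrow> complex) set" where
  "linf M = {f \<in> borel_measurable M. bounded (f ` space M)}"

definition linf_norm :: "'a measure \<Rightarrow> ('a \<Rightarrow> complex) \<Rightarrow> ennreal" where
  "linf_norm M f = (SUP x\<in>space M. ennreal (norm (f x)))"

text \<open>
  Integral projective decompositions over a family \<open>M\<close>, indexed by the finite set \<open>I\<close>, of Polish
  spaces with their Borel \<open>\<sigma>\<close>-algebras (only the measurable-space part of each \<open>M j\<close> is used).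
  The Borel \<open>\<sigma>\<close>-algebra of the product is that of \<open>Pi\<^sub>M I M\<close>.
  For such \<open>M\<close> the integrand of \<open>ipd_cost\<close> is measurable with respect to the completion
  (measurable projection theorem), so the nonnegative integral there is a genuine integral.
\<close>

definition ipd_cost :: "'i set \<Rightarrow> ('i \<Rightarrow> 'a measure) \<Rightarrow> 's measure \<Rightarrow>
    ('i \<Rightarrow> 'a \<Rightarrow> 's \<Rightarrow> complex) \<Rightarrow> ennreal" where
  "ipd_cost I M S p = (\<integral>\<^sup>+ s. (\<Prod>j\<in>I. linf_norm (M j) (\<lambda>x. p j x s)) \<partial>completion S)"

definition is_ipd :: "'i set \<Rightarrow> ('i \<Rightarrow> 'a measure) \<Rightarrow> (('i \<Rightarrow> 'a) \<Rightarrow> complex) \<Rightarrow>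
    's measure \<Rightarrow> ('i \<Rightarrow> 'a \<Rightarrow> 's \<Rightarrow> complex) \<Rightarrow> bool" where
  "is_ipd I M F S p \<longleftrightarrow>
     sigma_finite_measure S \<and>
     (\<forall>j\<in>I. (\<lambda>(x, s). p j x s) \<in> borel_measurable (M j \<Otimes>\<^sub>M S)) \<and>
     (\<forall>j\<in>I. \<forall>s\<in>space S. (\<lambda>x. p j x s) \<in> linf (M j)) \<and>
     ipd_cost I M S p < \<infinity> \<and>
     (\<forall>w\<in>space (Pi\<^sub>M I M). F w = (\<integral>s. (\<Prod>j\<in>I. p j (w j) s) \<partial>S))"

text \<open>
  HOL cannot quantify over the carrier type of the parameter space \<open>\<Sigma>\<close> inside a definition.
  The type \<open>'s\<close> whose subsets serve as carriers is therefore an explicit parameter; theorems are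
  to be stated for all \<open>'s\<close>.
  (For Polish factors every \<open>'s\<close> at least as large as the reals gives the same norm: the
  functions in a decomposition are measurable for a countably generated sub-\<open>\<sigma>\<close>-algebra of
  \<open>\<Sigma>\<close>, so the decomposition can be pushed forward to the real line.)
\<close>

definition iptp_norm :: "'s itself \<Rightarrow> 'i set \<Rightarrow> ('i \<Rightarrow> 'a measure) \<Rightarrow>
    (('i \<Rightarrow> 'a) \<Rightarrow> complex) \<Rightarrow> ennreal" where
  "iptp_norm T I M F = Inf {ipd_cost I M S p | (S :: 's measure) p. is_ipd I M F S p}"

definition iptp :: "'s itself \<Rightarrow> 'i set \<Rightarrow> ('i \<Rightarrow> 'a measure) \<Rightarrow> (('i \<Rightarrow> 'a) \<Rightarrow> complex) set" where
  "iptp T I M = {F \<in> linf (Pi\<^sub>M I M). iptp_norm T I M F < \<infinity>}"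

definition iptp_converges :: "'s itself \<Rightarrow> 'i set \<Rightarrow> ('i \<Rightarrow> 'a measure) \<Rightarrow>
    (nat \<Rightarrow> ('i \<Rightarrow> 'a) \<Rightarrow> complex) \<Rightarrow> (('i \<Rightarrow> 'a) \<Rightarrow> complex) \<Rightarrow> bool" where
  "iptp_converges T I M G F \<longleftrightarrow>
     (\<forall>n. G n \<in> iptp T I M) \<and> F \<in> iptp T I M \<and>
     (\<lambda>n. iptp_norm T I M (\<lambda>w. G n w - F w)) \<longlonglongrightarrow> 0"


text \<open>
  Restriction to \<open>[-r, r]\<^sup>j\<^sup>+\<^sup>1\<close> is implicit: the notions above only look at functions on the
  space of the product, here \<open>{..j} \<rightarrow>\<^sub>E {-r..r}\<close>.
\<close>

definition NCk :: "'s itself \<Rightarrow> nat \<Rightarrow> (real \<Rightarrow> complex) set" where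
  "NCk T k = {f \<in> Ck k. \<exists>q :: nat \<Rightarrow> complex poly. \<forall>r>0. \<forall>j\<le>k.
     iptp_converges T {..j} (\<lambda>_. restrict_space borel {-r..r})
       (\<lambda>n. divdiff_ext (\<lambda>x. poly (q n) (of_real x)) j) (divdiff_ext f j)}"


definition h_fun :: "(real \<Rightarrow> complex) \<Rightarrow> real \<Rightarrow> complex" where
  "h_fun \<eta> x = indicator {0<..<1} \<bar>x\<bar> *
     (\<eta> x * of_real \<bar>x\<bar> / of_real (sqrt (ln \<bar>ln \<bar>x\<bar> - 1\<bar>)))"

definition f_fun :: "(real \<Rightarrow> complex) \<Rightarrow> nat \<Rightarrow> real \<Rightarrow> complex" where
  "f_fun \<eta> k x = of_real x ^ (k - 1) * h_fun \<eta> x"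

end

theory Submission
  imports Defs
begin

text \<open>
  Membership of \<open>f\<^sub>k\<close> in \<open>C\<^sup>k\<close> comes from a family of functions that is closed under
  differentiation. With \<open>L = 1 - ln \<bar>x\<bar>\<close>, consider \<open>x\<^sup>m sgn x (ln L)\<^sup>-\<^sup>a L\<^sup>-\<^sup>b \<eta>(x)\<close> with \<open>a > 0\<close> and
  \<open>b \<ge> 0\<close>. The Euler operator \<open>x d/dx\<close> maps the logarithmic factor to a combination of factors of
  the same kind, so each derivative lowers \<open>m\<close> by one, and for \<open>m = 0\<close> the function is continuous
  since \<open>(ln L)\<^sup>-\<^sup>a\<close> tends to 0 at the origin. The function \<open>f\<^sub>k\<close> is the case \<open>m = k\<close>, \<open>a = 1/2\<close>,
  \<open>b = 0\<close> (lemma \<open>log_scale_power_Ck\<close>).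

  Failure of \<open>f\<^sub>k \<in> NC\<^sup>k\<close> is a duality argument. If \<open>F\<close> has finite integral projective norm, then
  every finite linear combination of point evaluations that is bounded by 1 on products of functions
  bounded by 1 is bounded on \<open>F\<close> by that norm (\<open>iptp_functional_bound\<close>). Hilbert's
  inequality provides such functionals: on products,
  \<open>\<Sum>\<^sub>i\<^sub>,\<^sub>j F(x\<^sub>i, y\<^sub>j) / (i - j)\<close> over \<open>i \<noteq> j\<close> in \<open>{1..n}\<close> is at most \<open>\<pi> n\<close> in modulus
  (\<open>hilbert_inequality\<close>). For \<open>k > 1\<close> the other \<open>k - 1\<close> arguments of \<open>f\<^sub>k\<^sup>[\<^sup>k\<^sup>]\<close> are fixed
  and contribute only a bounded factor. Letting them tend to 0 one at a time replaces
  \<open>f\<^sub>k\<^sup>[\<^sup>k\<^sup>]\<close> by \<open>h\<^sup>[\<^sup>1\<^sup>]\<close>, because of the Leibniz rule for multiplication by the variable,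
  \<open>(x g)\<^sup>[\<^sup>j\<^sup>+\<^sup>1\<^sup>](l\<^sub>0, \<dots>, l\<^sub>j\<^sub>+\<^sub>1) = l\<^sub>j\<^sub>+\<^sub>1 g\<^sup>[\<^sup>j\<^sup>+\<^sup>1\<^sup>](l\<^sub>0, \<dots>, l\<^sub>j\<^sub>+\<^sub>1) + g\<^sup>[\<^sup>j\<^sup>](l\<^sub>0, \<dots>, l\<^sub>j)\<close>.
  So if \<open>f\<^sub>k\<close> were in \<open>NC\<^sup>k\<close>, the Hilbert sums of \<open>h\<^sup>[\<^sup>1\<^sup>]\<close> would be \<open>O(n)\<close>
  (\<open>NCk_hilbert_bounded\<close>).

  Now take \<open>x\<^sub>i = exp (- i)\<close> and \<open>y\<^sub>j = - x\<^sub>j\<close>. On these points \<open>h\<close> is even, and it increases with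
  the modulus, so \<open>h\<^sup>[\<^sup>1\<^sup>](x\<^sub>i, y\<^sub>j) = (h(x\<^sub>i) - h(x\<^sub>j)) / (x\<^sub>i + x\<^sub>j)\<close> has the sign of \<open>j - i\<close>; for
  \<open>i \<noteq> j\<close> its modulus is at least \<open>1 / (3 sqrt (ln (1 + n)))\<close>. All terms of the Hilbert sum then have
  the same sign, and the sum is of order at least \<open>n ln n / sqrt (ln n)\<close>, which is not \<open>O(n)\<close>
  (\<open>log_damped_hilbert_unbounded\<close>).

  The polynomials in the definition of \<open>NC\<^sup>k\<close> serve to identify the continuous extension of
  \<open>f\<^sup>[\<^sup>k\<^sup>]\<close> with the divided difference at distinct points: for polynomials the extension
  is explicit, and convergence in norm implies pointwise convergence.
\<close>

section \<open>Functions of class \<open>C\<^sup>k\<close>\<close>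

lemma Ck_SucI:
  assumes "\<And>x. (f has_vector_derivative f' x) (at x)" "f' \<in> Ck k"
  shows "f \<in> Ck (Suc k)"
  using assms by auto

lemma Ck_SucD: "f \<in> Ck (Suc k) \<Longrightarrow> f \<in> Ck k"
proof (induction k arbitrary: f)
  case 0
  then obtain f' where "\<And>x. (f has_vector_derivative f' x) (at x)" by auto
  then show ?case
    by (auto intro!: continuous_at_imp_continuous_on has_vector_derivative_continuous)
next
  case (Suc k)
  obtain f' where d: "\<And>x. (f has_vector_derivative f' x) (at x)" "f' \<in> Ck (Suc k)"
    using Suc.prems unfolding Ck.simps(2)[of "Suc k"] by blast
  show ?case by (rule Ck_SucI[OF d(1) Suc.IH[OF d(2)]])
qed

lemma Ck_const: "(\<lambda>_. c) \<in> Ck k"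
proof (induction k arbitrary: c)
  case (Suc k)
  then show ?case by (auto intro!: exI[of _ "\<lambda>_. 0"])
qed auto

lemma Ck_of_real: "of_real \<in> Ck k"
proof (cases k)
  case (Suc m)
  have "(of_real has_vector_derivative (1::complex)) (at x)" for x :: real
    using has_vector_derivative_of_real[OF DERIV_ident, of "at x"] by simp
  then show ?thesis unfolding Suc by (intro Ck_SucI[where f'="\<lambda>_. 1"] Ck_const)
qed (simp add: continuous_on_of_real_id)

lemma Ck_add: "f \<in> Ck k \<Longrightarrow> g \<in> Ck k \<Longrightarrow> (\<lambda>x. f x + g x) \<in> Ck k"
proof (induction k arbitrary: f g)
  case (Suc k)
  obtain f' g' where d: "\<And>x. (f has_vector_derivative f' x) (at x)" "f' \<in> Ck k"
    "\<And>x. (g has_vector_derivative g' x) (at x)" "g' \<in> Ck k"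
    using Suc.prems by auto
  show ?case by (rule Ck_SucI[OF has_vector_derivative_add[OF d(1,3)] Suc.IH[OF d(2,4)]])
qed (simp add: continuous_on_add)

lemma Ck_mult: "f \<in> Ck k \<Longrightarrow> g \<in> Ck k \<Longrightarrow> (\<lambda>x. f x * g x) \<in> Ck k"
proof (induction k arbitrary: f g)
  case (Suc k)
  obtain f' g' where d: "\<And>x. (f has_vector_derivative f' x) (at x)" "f' \<in> Ck k"
    "\<And>x. (g has_vector_derivative g' x) (at x)" "g' \<in> Ck k"
    using Suc.prems by auto
  have "(\<lambda>x. f x * g' x + f' x * g x) \<in> Ck k"
    using Suc.IH[OF Ck_SucD[OF Suc.prems(1)] d(4)] Suc.IH[OF d(2) Ck_SucD[OF Suc.prems(2)]]
    by (rule Ck_add)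
  then show ?case by (rule Ck_SucI[OF has_vector_derivative_mult[OF d(1,3)]])
qed (simp add: continuous_on_mult)

text \<open>
  Compositions of \<open>t \<mapsto> max 0 t ^ Suc k\<close> with polynomials provide \<open>C\<^sup>k\<close> cutoffs that are exactly 1
  on one set and exactly 0 on another.
\<close>

lemma Ck_pos_part_power:
  assumes "(\<lambda>x. complex_of_real (u x)) \<in> Ck k"
  shows "(\<lambda>x. complex_of_real (max 0 (u x) ^ Suc k)) \<in> Ck k"
proof -
  have "(\<lambda>x. complex_of_real (max 0 (u x) ^ Suc m)) \<in> Ck k"
    if "(\<lambda>x. complex_of_real (u x)) \<in> Ck k" "m \<ge> k" for m
    using that
  proof (induction k arbitrary: m)
    case 0
    then have "continuous_on UNIV (\<lambda>x. Re (complex_of_real (u x)))"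
      by (intro continuous_intros) auto
    then show ?case by (auto intro!: continuous_intros)
  next
    case (Suc k)
    obtain u' where u': "\<And>x. ((\<lambda>x. complex_of_real (u x)) has_vector_derivative u' x) (at x)" "u' \<in> Ck k"
      using Suc.prems by auto
    obtain m' where m: "m = Suc m'" using Suc.prems by (cases m) auto
    have ud: "(u has_real_derivative Re (u' x)) (at x)" for x
      using has_field_derivative_Re[OF u'(1)[of x]] by simp
    have re: "of_real (Re (u' x)) = u' x" for x
      using vector_derivative_unique_at[OF u'(1)[of x] has_vector_derivative_of_real[OF ud[of x]]] by simp
    have P: "((\<lambda>t. max 0 t ^ Suc m) has_real_derivative real (Suc m) * max 0 t ^ m) (at t)" for t :: real
    proof -
      consider "t > 0" | "t < 0" | "t = 0" by linarith
      then show ?thesis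
      proof cases
        case 1
        have "((\<lambda>t. t ^ Suc m) has_real_derivative real (Suc m) * t ^ m) (at t)"
          by (rule derivative_eq_intros refl | simp)+
        then have "((\<lambda>t. max 0 t ^ Suc m) has_real_derivative real (Suc m) * t ^ m) (at t)"
          by (rule has_field_derivative_transform_within_open[where S="{0<..}"]) (use 1 in auto)
        then show ?thesis using 1 by simp
      next
        case 2
        have "((\<lambda>t. 0) has_real_derivative 0) (at t)" by simp
        then have "((\<lambda>t. max 0 t ^ Suc m) has_real_derivative 0) (at t)"
          by (rule has_field_derivative_transform_within_open[where S="{..<0}"]) (use 2 in auto)
        then show ?thesis using 2 by (simp add: m)
      next
        case 3
        have l: "((\<lambda>y::real. \<bar>y\<bar> ^ m) \<longlongrightarrow> \<bar>0\<bar> ^ m) (at 0)" by (intro tendsto_intros)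
        have "((\<lambda>y::real. max 0 y ^ Suc m / y) \<longlongrightarrow> 0) (at 0)"
        proof (rule Lim_null_comparison)
          show "\<forall>\<^sub>F y::real in at 0. norm (max 0 y ^ Suc m / y) \<le> \<bar>y\<bar> ^ m"
            by (auto simp: eventually_at_filter max_def intro!: always_eventually)
          show "((\<lambda>y::real. \<bar>y\<bar> ^ m) \<longlongrightarrow> 0) (at 0)" using l by (simp add: m)
        qed
        then show ?thesis using 3 by (simp add: has_field_derivative_iff m)
      qed
    qed
    have d: "((\<lambda>x. complex_of_real (max 0 (u x) ^ Suc m)) has_vector_derivative
       of_nat (Suc m) * of_real (max 0 (u x) ^ m) * u' x) (at x)" for x
      using has_vector_derivative_of_real[OF DERIV_chain2[OF P ud], of x, where 'a=complex]
      by (simp only: of_real_mult re of_real_of_nat_eq)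
    have "(\<lambda>x. of_nat (Suc m) * of_real (max 0 (u x) ^ m) * u' x) \<in> Ck k"
      using Suc.IH[OF Ck_SucD[OF Suc.prems(1)], of m'] Suc.prems u'(2) m
      by (intro Ck_mult Ck_const) auto
    then show ?case by (rule Ck_SucI[OF d])
  qed
  then show ?thesis using assms by blast
qed

text \<open>
  For a function in \<open>C\<^sup>k\<close> but not in \<open>NC\<^sup>k\<close> a cutoff of finite smoothness suffices.
\<close>

lemma exists_Ck_cutoff:
  obtains \<eta> where "\<eta> \<in> Ck k" "\<And>x. \<bar>x\<bar> \<le> 1/2 \<Longrightarrow> \<eta> x = 1" "\<And>x. \<bar>x\<bar> > 9/10 \<Longrightarrow> \<eta> x = 0"
proof
  let ?P = "\<lambda>t::real. max 0 t ^ Suc k"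
  \<comment> \<open>The inner argument is at most 0 for \<open>\<bar>x\<bar> \<le> 1/2\<close> and at least 1 for \<open>\<bar>x\<bar> \<ge> 9/10\<close>.\<close>
  let ?\<eta> = "\<lambda>x. complex_of_real (?P (1 - ?P (2 * x^2 - 1/2)))"
  have "(\<lambda>x. 2 * (complex_of_real x * complex_of_real x) + -(1/2)) \<in> Ck k"
    by (intro Ck_add Ck_mult Ck_const Ck_of_real)
  then have "(\<lambda>x. complex_of_real (2 * x^2 - 1/2)) \<in> Ck k"
    by (simp add: power2_eq_square)
  from Ck_pos_part_power[OF this]
  have "(\<lambda>x. 1 + (-1) * complex_of_real (?P (2 * x^2 - 1/2))) \<in> Ck k"
    by (intro Ck_add Ck_mult Ck_const)
  then have "(\<lambda>x. complex_of_real (1 - ?P (2 * x^2 - 1/2))) \<in> Ck k"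
    by simp
  from Ck_pos_part_power[OF this] show "?\<eta> \<in> Ck k" .
  show "?\<eta> x = 1" if "\<bar>x\<bar> \<le> 1/2" for x
  proof -
    have "\<bar>x\<bar>^2 \<le> (1/2)^2" using that by (intro power_mono) auto
    then have "max 0 (2 * x^2 - 1/2) = 0" by (simp add: power2_eq_square)
    then show ?thesis by simp
  qed
  show "?\<eta> x = 0" if "\<bar>x\<bar> > 9/10" for x
  proof -
    have "\<bar>x\<bar>^2 \<ge> (9/10)^2" using that by (intro power_mono) auto
    then have "1 \<le> max 0 (2 * x^2 - 1/2)" by (simp add: power2_eq_square)
    then have "1 \<le> ?P (2 * x^2 - 1/2)" by (rule one_le_power)
    then have "max 0 (1 - ?P (2 * x^2 - 1/2)) = 0" by simp
    then show ?thesis by simp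
  qed
qed

section \<open>The logarithmic scale\<close>

definition log_scale :: "real \<Rightarrow> real \<Rightarrow> real \<Rightarrow> real" where
  "log_scale a b x = ln (1 - ln \<bar>x\<bar>) powr (- a) * (1 - ln \<bar>x\<bar>) powr (- b)"

text \<open>
  The exponent \<open>m\<close> counts powers of \<open>x\<close>; for \<open>m > 0\<close> the factor \<open>sgn x\<close> turns one of them into
  \<open>\<bar>x\<bar>\<close>.
\<close>

definition log_scale_power :: "(real \<Rightarrow> complex) \<Rightarrow> nat \<Rightarrow> real \<Rightarrow> real \<Rightarrow> real \<Rightarrow> complex" where
  "log_scale_power \<eta> m a b x =
     (if 0 < \<bar>x\<bar> \<and> \<bar>x\<bar> < 1 then of_real (x ^ m * sgn x * log_scale a b x) * \<eta> x else 0)"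

lemma log_scale_tendsto_0:
  assumes "a > 0" "b \<ge> 0"
  shows "(log_scale a b \<longlongrightarrow> 0) (at 0)"
proof -
  have "((\<lambda>x. ln (1 - ln x) powr (- a)) \<longlongrightarrow> 0) (at_right 0)"
  proof (rule tendsto_neg_powr)
    show "- a < 0" using assms(1) by simp
    have "filterlim (\<lambda>x::real. - ln x) at_top (at_right 0)"
      using ln_at_0 unfolding filterlim_uminus_at_bot .
    from filterlim_tendsto_add_at_top[OF tendsto_const[of 1] this]
    have "filterlim (\<lambda>x::real. 1 - ln x) at_top (at_right 0)" by simp
    then show "filterlim (\<lambda>x::real. ln (1 - ln x)) at_top (at_right 0)"
      by (rule filterlim_compose[OF ln_at_top])
  qed
  moreover have "filterlim (\<lambda>x::real. \<bar>x\<bar>) (at_right 0) (at 0)"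
    unfolding filterlim_at
    by (rule conjI, simp add: eventually_at_filter, rule tendsto_rabs_zero[OF tendsto_ident_at])
  ultimately have lim: "((\<lambda>x. ln (1 - ln \<bar>x\<bar>) powr (- a)) \<longlongrightarrow> 0) (at 0)"
    by (rule filterlim_compose)
  show ?thesis
  proof (rule Lim_null_comparison[OF _ lim])
    have "eventually (\<lambda>x::real. x \<in> {-1<..<1} - {0}) (at 0)"
      by (rule eventually_at_in_open) simp_all
    then show "eventually (\<lambda>x. norm (log_scale a b x) \<le> ln (1 - ln \<bar>x\<bar>) powr (- a)) (at 0)"
    proof eventually_elim
      case (elim x)
      then have "ln \<bar>x\<bar> < 0" by (auto simp: abs_if)
      then have "(1 - ln \<bar>x\<bar>) powr (- b) \<le> (1 - ln \<bar>x\<bar>) powr 0"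
        using assms by (intro powr_mono) auto
      then have "(1 - ln \<bar>x\<bar>) powr (- b) \<le> 1" using \<open>ln \<bar>x\<bar> < 0\<close> by simp
      then show ?case by (auto simp: log_scale_def abs_mult intro!: mult_left_le)
    qed
  qed
qed

text \<open>
  The scale is closed under \<open>x d/dx\<close>, because \<open>x d/dx\<close> maps \<open>1 - ln \<bar>x\<bar>\<close> to \<open>- 1\<close>.
\<close>

lemma log_scale_DERIV:
  assumes "0 < \<bar>x\<bar>" "\<bar>x\<bar> < 1"
  shows "(log_scale a b has_real_derivative
     (a * log_scale (a+1) (b+1) x + b * log_scale a (b+1) x) / x) (at x)"
proof -
  have L: "ln \<bar>x\<bar> < 0" using assms by simp
  have "((\<lambda>x. ln \<bar>x\<bar>) has_real_derivative 1 / x) (at x)"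
  proof (cases "x > 0")
    case True
    have "(ln has_real_derivative 1 / x) (at x)" using True by (auto intro!: derivative_eq_intros)
    then show ?thesis
      by (rule has_field_derivative_transform_within_open[where S="{0<..}"]) (use True in auto)
  next
    case False
    with assms have "x < 0" by auto
    have "((\<lambda>x. ln (- x)) has_real_derivative 1 / x) (at x)"
      using \<open>x < 0\<close> by (auto intro!: derivative_eq_intros)
    then show ?thesis
      by (rule has_field_derivative_transform_within_open[where S="{..<0}"]) (use \<open>x < 0\<close> in auto)
  qed
  from DERIV_diff[OF DERIV_const[of 1] this]
  have d1: "((\<lambda>x. 1 - ln \<bar>x\<bar>) has_real_derivative - (1 / x)) (at x)"
    by simp
  define T l where "T = 1 - ln \<bar>x\<bar>" and "l = ln T"
  have p: "0 < 1 - ln \<bar>x\<bar>" "0 < ln (1 - ln \<bar>x\<bar>)" using L by simp_all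
  then have p': "T > 0" "l > 0" by (auto simp: T_def l_def)
  have d2: "((\<lambda>x. ln (1 - ln \<bar>x\<bar>)) has_real_derivative - (1 / x) / (1 - ln \<bar>x\<bar>)) (at x)"
    using DERIV_chain2[OF DERIV_ln[OF p(1)] d1] by (simp add: field_simps)
  have e: "ln (1 - ln \<bar>x\<bar>) powr (- a - 1) = ln (1 - ln \<bar>x\<bar>) powr (- a) / ln (1 - ln \<bar>x\<bar>)"
     "(1 - ln \<bar>x\<bar>) powr (- b - 1) = (1 - ln \<bar>x\<bar>) powr (- b) / (1 - ln \<bar>x\<bar>)"
    using p by (auto simp: powr_diff)
  have e': "- (a+1) = - a - 1" "- (b+1) = - b - 1" by auto
  have eq: "- a * (l powr - a / l) * (- (1 / x) / T) * T powr - b +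
       - b * (T powr - b / T) * - (1 / x) * l powr - a =
       (a * (l powr - a / l * (T powr - b / T)) + b * (l powr - a * (T powr - b / T))) / x"
    using p' assms by (simp add: add_divide_distrib mult_ac)
  show ?thesis
    using DERIV_cong[OF DERIV_mult[OF DERIV_fun_powr[OF d2 p(2), of "-a"] DERIV_fun_powr[OF d1 p(1), of "-b"]]] eq
    unfolding log_scale_def[abs_def] e' of_nat_1 e
    unfolding T_def[symmetric] l_def[symmetric] by blast
qed

text \<open>
  Away from the origin this is the product rule. At the origin the modulus of the difference quotient
  is that of the function with exponent \<open>m\<close> in place of \<open>Suc m\<close>, which tends to 0 since \<open>a > 0\<close>. The
  bound \<open>c < 1\<close> on the support of \<open>\<eta>\<close> keeps the singularity of the scale at \<open>\<bar>x\<bar> = 1\<close> away.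
\<close>

lemma log_scale_power_has_vector_derivative:
  assumes ab: "a > 0" "b \<ge> 0" and c: "c < 1" "\<And>x. \<bar>x\<bar> > c \<Longrightarrow> \<eta> x = 0"
    and \<eta>': "\<And>x. (\<eta> has_vector_derivative \<eta>' x) (at x)"
  shows "(log_scale_power \<eta> (Suc m) a b has_vector_derivative
     of_nat (Suc m) * log_scale_power \<eta> m a b x + of_real a * log_scale_power \<eta> m (a+1) (b+1) x
     + of_real b * log_scale_power \<eta> m a (b+1) x
     + log_scale_power (\<lambda>x. of_real x * \<eta>' x) m a b x) (at x)" (is "(_ has_vector_derivative ?D) _")
proof -
  consider "x = 0" | "0 < \<bar>x\<bar>" "\<bar>x\<bar> < 1" | "\<bar>x\<bar> > c" "x \<noteq> 0" using c by fastforce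
  then show ?thesis
  proof cases
    case 1
    have "isCont \<eta> 0" using \<eta>' has_vector_derivative_continuous by blast
    then have "((\<lambda>x. of_real (x ^ m * log_scale a b x) * \<eta> x) \<longlongrightarrow> of_real (0 ^ m * 0) * \<eta> 0) (at 0)"
      using log_scale_tendsto_0[OF ab] unfolding isCont_def by (intro tendsto_intros)
    then have l0: "((\<lambda>x. norm (of_real (x ^ m * log_scale a b x) * \<eta> x)) \<longlongrightarrow> 0) (at 0)"
      using tendsto_norm_zero by fastforce
    have "((\<lambda>y. norm (log_scale_power \<eta> (Suc m) a b y) / \<bar>y\<bar>) \<longlongrightarrow> 0) (at 0)"
    proof (rule Lim_null_comparison[OF _ l0])
      show "\<forall>\<^sub>F x in at 0. norm (norm (log_scale_power \<eta> (Suc m) a b x) / \<bar>x\<bar>)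
         \<le> norm (complex_of_real (x ^ m * log_scale a b x) * \<eta> x)"
        by (auto simp: eventually_at_filter log_scale_power_def norm_mult abs_mult abs_sgn_eq power_abs
            intro!: always_eventually)
    qed
    then show ?thesis using 1
      by (simp add: has_vector_derivative_def has_derivative_iff_norm log_scale_power_def)
  next
    case 2
    define S where "S = {-1<..<1} - {0::real}"
    have S: "open S" "x \<in> S" using 2 by (auto simp: S_def)
    have sg: "(sgn has_real_derivative 0) (at x)"
    proof (rule has_field_derivative_transform_within_open[where S="if x > 0 then {0<..} else {..<0}"])
      show "((\<lambda>_. sgn x) has_real_derivative 0) (at x)" by simp
    qed (use 2 in \<open>auto split: if_splits\<close>)
    let ?r = "\<lambda>x. x ^ Suc m * sgn x * log_scale a b x"
    have "(?r has_real_derivative (real (Suc m) * x ^ m * sgn x * log_scale a b x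
       + x ^ m * sgn x * (a * log_scale (a+1) (b+1) x + b * log_scale a (b+1) x))) (at x)"
    proof (rule DERIV_cong[OF DERIV_mult[OF DERIV_mult[OF DERIV_pow sg] log_scale_DERIV[OF 2]]])
      show "(real (Suc m) * x ^ (Suc m - Suc 0) * sgn x + 0 * x ^ Suc m) * log_scale a b x +
        (a * log_scale (a + 1) (b + 1) x + b * log_scale a (b + 1) x) / x * (x ^ Suc m * sgn x) =
        real (Suc m) * x ^ m * sgn x * log_scale a b x +
        x ^ m * sgn x * (a * log_scale (a + 1) (b + 1) x + b * log_scale a (b + 1) x)"
        using 2 by simp
    qed
    from has_vector_derivative_mult[OF has_vector_derivative_of_real[OF this] \<eta>']
    have "((\<lambda>x. of_real (?r x) * \<eta> x) has_vector_derivative ?D) (at x)"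
      using 2 by (simp add: log_scale_power_def algebra_simps)
    then show ?thesis
      by (rule has_vector_derivative_transform_within_open[OF _ S])
         (auto simp: S_def log_scale_power_def)
  next
    case 3
    have op: "open {x. \<bar>x\<bar> > c}" by (intro open_Collect_less continuous_intros)
    have "(\<eta> has_vector_derivative 0) (at x)"
      by (rule has_vector_derivative_transform_within_open[OF has_vector_derivative_const op])
         (use 3 c in auto)
    then have "\<eta>' x = 0" using \<eta>' vector_derivative_unique_at by blast
    then have D: "?D = 0" using c 3 by (auto simp: log_scale_power_def)
    show ?thesis unfolding D
      by (rule has_vector_derivative_transform_within_open[OF has_vector_derivative_const op])
         (use 3 c in \<open>auto simp: log_scale_power_def\<close>)
  qed
qed

text \<open>
  By induction on \<open>k\<close>: the four terms of the derivative belong to the same family with exponent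
  lowered by one, and in the last of them \<open>x \<eta>'(x)\<close> takes the role of the cutoff.
\<close>

lemma log_scale_power_Ck:
  assumes "a > 0" "b \<ge> 0" "c < 1" "\<And>x. \<bar>x\<bar> > c \<Longrightarrow> \<eta> x = 0" "\<eta> \<in> Ck k"
  shows "log_scale_power \<eta> k a b \<in> Ck k"
  using assms
proof (induction k arbitrary: a b \<eta>)
  case 0
  have "isCont (log_scale_power \<eta> 0 a b) x" for x
  proof -
    have \<eta>: "isCont \<eta> y" for y using 0 by (simp add: continuous_on_eq_continuous_at)
    consider "x = 0" | "0 < \<bar>x\<bar>" "\<bar>x\<bar> < 1" | "\<bar>x\<bar> > c" using 0 by fastforce
    then show ?thesis
    proof cases
      case 1
      have "((\<lambda>x. of_real (log_scale a b x) * \<eta> x) \<longlongrightarrow> of_real 0 * \<eta> 0) (at 0)"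
        using log_scale_tendsto_0[OF 0(1,2)] \<eta>[of 0] unfolding isCont_def by (intro tendsto_intros)
      then have l0: "((\<lambda>x. norm (of_real (log_scale a b x) * \<eta> x)) \<longlongrightarrow> 0) (at 0)"
        using tendsto_norm_zero by fastforce
      have "(log_scale_power \<eta> 0 a b \<longlongrightarrow> 0) (at 0)"
        by (rule Lim_null_comparison[OF _ l0])
          (auto simp: eventually_at_filter log_scale_power_def norm_mult abs_mult abs_sgn_eq
            intro!: always_eventually)
      then show ?thesis using 1 by (simp add: isCont_def log_scale_power_def)
    next
      case 2
      have "isCont (log_scale a b) x" using DERIV_isCont[OF log_scale_DERIV[OF 2]] .
      then have "isCont (\<lambda>x. of_real (x ^ 0 * sgn x * log_scale a b x) * \<eta> x) x"
        using \<eta> 2 by (intro continuous_intros) auto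
      then show ?thesis
      proof (subst isCont_cong)
        have "eventually (\<lambda>y. y \<in> {-1<..<1} - {0}) (nhds x)"
          using 2 by (intro eventually_nhds_in_open) (auto simp: abs_if split: if_splits)
        then show "\<forall>\<^sub>F y in nhds x. log_scale_power \<eta> 0 a b y = of_real (y ^ 0 * sgn y * log_scale a b y) * \<eta> y"
          by eventually_elim (auto simp: log_scale_power_def)
      qed
    next
      case 3
      have op: "open {x. \<bar>x\<bar> > c}" by (intro open_Collect_less continuous_intros)
      show ?thesis
      proof (subst isCont_cong)
        have "eventually (\<lambda>y. y \<in> {x. \<bar>x\<bar> > c}) (nhds x)"
          using 3 by (intro eventually_nhds_in_open op) auto
        then show "\<forall>\<^sub>F y in nhds x. log_scale_power \<eta> 0 a b y = 0"
          by eventually_elim (use 0 in \<open>auto simp: log_scale_power_def\<close>)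
      qed auto
    qed
  qed
  then show ?case by (simp add: continuous_at_imp_continuous_on)
next
  case (Suc k)
  obtain \<eta>' where \<eta>': "\<And>x. (\<eta> has_vector_derivative \<eta>' x) (at x)" "\<eta>' \<in> Ck k"
    using Suc.prems by auto
  have z: "\<eta>' x = 0" if "\<bar>x\<bar> > c" for x
  proof -
    have op: "open {x. \<bar>x\<bar> > c}" by (intro open_Collect_less continuous_intros)
    have "(\<eta> has_vector_derivative 0) (at x)"
      by (rule has_vector_derivative_transform_within_open[OF has_vector_derivative_const op])
         (use that Suc.prems in auto)
    then show ?thesis using \<eta>' vector_derivative_unique_at by blast
  qed
  note \<eta>k = Ck_SucD[OF Suc.prems(5)]
  note ind = Suc.IH[OF _ _ Suc.prems(3)]
  have "(\<lambda>x. of_nat (Suc k) * log_scale_power \<eta> k a b x + of_real a * log_scale_power \<eta> k (a+1) (b+1) x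
     + of_real b * log_scale_power \<eta> k a (b+1) x
     + log_scale_power (\<lambda>x. of_real x * \<eta>' x) k a b x) \<in> Ck k"
    using Suc.prems z \<eta>k \<eta>' by (intro Ck_add Ck_mult Ck_const ind) (auto intro: Ck_of_real)
  with log_scale_power_has_vector_derivative[OF Suc.prems(1-4) \<eta>'(1)]
  show ?case by (rule Ck_SucI)
qed

lemma f_fun_eq_log_scale_power:
  assumes "k \<ge> 1"
  shows "f_fun \<eta> k = log_scale_power \<eta> k (1/2) 0"
proof
  fix x
  show "f_fun \<eta> k x = log_scale_power \<eta> k (1/2) 0 x"
  proof (cases "0 < \<bar>x\<bar> \<and> \<bar>x\<bar> < 1")
    case True
    then have L: "ln \<bar>x\<bar> < 0" by simp
    have "x ^ k = x ^ (k-1) * x" using assms by (cases k) auto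
    then have "x ^ k * sgn x = x ^ (k - 1) * \<bar>x\<bar>"
      by (metis abs_sgn mult.assoc)
    moreover have "log_scale (1/2) 0 x = 1 / sqrt (ln \<bar>ln \<bar>x\<bar> - 1\<bar>)"
      using L by (auto simp: log_scale_def powr_minus powr_half_sqrt field_simps)
    ultimately show ?thesis using True
      by (simp add: f_fun_def h_fun_def log_scale_power_def indicator_def)
  qed (auto simp: f_fun_def h_fun_def log_scale_power_def indicator_def)
qed

lemma f_fun_Ck:
  assumes "k \<ge> 1" "c < 1" "\<And>x. \<bar>x\<bar> > c \<Longrightarrow> \<eta> x = 0" "\<eta> \<in> Ck k"
  shows "f_fun \<eta> k \<in> Ck k"
  unfolding f_fun_eq_log_scale_power[OF assms(1)]
  using assms by (intro log_scale_power_Ck[where c=c]) auto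

section \<open>Hilbert's inequality\<close>

lemma cis_has_vector_derivative:
  "((\<lambda>t. cis (a * t)) has_vector_derivative \<i> * of_real a * cis (a * t)) (at t within S)"
  unfolding has_vector_derivative_complex_iff
  by (auto intro!: derivative_eq_intros)

lemma has_integral_cis_int:
  fixes m :: int
  shows "((\<lambda>t. cis (of_int m * t)) has_integral (if m = 0 then 2 * of_real pi else 0)) {0..2*pi}"
proof (cases "m = 0")
  case True
  then show ?thesis using has_integral_const_real[of "1::complex" 0 "2*pi"]
    by (simp add: scaleR_conv_of_real)
next
  case False
  have "((\<lambda>t. cis (of_int m * t)) has_integral
      (cis (of_int m * (2*pi)) / (\<i> * of_int m) - cis (of_int m * 0) / (\<i> * of_int m))) {0..2*pi}"
  proof (rule fundamental_theorem_of_calculus)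
    fix t
    show "((\<lambda>t. cis (of_int m * t) / (\<i> * of_int m)) has_vector_derivative cis (of_int m * t))
       (at t within {0..2*pi})"
      using has_vector_derivative_divide[OF cis_has_vector_derivative[of "of_int m" t "{0..2*pi}"],
          of "\<i> * of_int m"] False by simp
  qed simp
  moreover have "cis (of_int m * (2*pi)) = 1"
    using cis_multiple_2pi[of "of_int m"] by (simp add: mult_ac)
  ultimately show ?thesis using False by simp
qed

text \<open>
  The Hilbert matrix is, up to a constant, the matrix of Fourier coefficients of the sawtooth
  \<open>\<pi> - t\<close>. For \<open>m = 0\<close> the convention \<open>z / 0 = 0\<close> gives the correct value.
\<close>

lemma has_integral_sawtooth_cis:
  fixes m :: int
  shows "((\<lambda>t. of_real (pi - t) * cis (of_int m * t)) has_integral 2 * of_real pi * \<i> / of_int m) {0..2*pi}"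
proof (cases "m = 0")
  case True
  have "((\<lambda>t. complex_of_real (pi - t)) has_integral
      (of_real (pi * (2*pi) - (2*pi)^2 / 2) - of_real (pi * 0 - 0^2 / 2))) {0..2*pi}"
  proof (rule fundamental_theorem_of_calculus)
    fix t :: real
    have "((\<lambda>t. pi * t - t^2 / 2) has_real_derivative pi - t) (at t within {0..2*pi})"
      by (auto intro!: derivative_eq_intros)
    then show "((\<lambda>t. complex_of_real (pi * t - t^2 / 2)) has_vector_derivative of_real (pi - t))
       (at t within {0..2*pi})"
      by (rule has_vector_derivative_of_real)
  qed simp
  then show ?thesis using True by (simp add: power2_eq_square)
next
  case False
  let ?F = "\<lambda>t. cis (of_int m * t) / (\<i> * of_int m)"
  have F: "(?F has_vector_derivative cis (of_int m * t)) (at t within {0..2*pi})" for t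
    using has_vector_derivative_divide[OF cis_has_vector_derivative[of "of_int m" t "{0..2*pi}"],
          of "\<i> * of_int m"] False by simp
  have "((\<lambda>t. of_real (pi - t) * cis (of_int m * t) + of_real (- 1) * ?F t) has_integral
      (of_real (pi - 2*pi) * ?F (2*pi) - of_real (pi - 0) * ?F 0)) {0..2*pi}"
  proof (rule fundamental_theorem_of_calculus)
    fix t :: real
    have "((\<lambda>t. pi - t) has_real_derivative - 1) (at t within {0..2*pi})"
      by (auto intro!: derivative_eq_intros)
    from has_vector_derivative_mult[OF has_vector_derivative_of_real[OF this] F[of t]]
    show "((\<lambda>t. of_real (pi - t) * ?F t) has_vector_derivative
        of_real (pi - t) * cis (of_int m * t) + of_real (- 1) * ?F t) (at t within {0..2*pi})" .
  qed simp
  moreover have "(?F has_integral 0) {0..2*pi}"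
    using has_integral_divide[OF has_integral_cis_int[of m], of "\<i> * of_int m"] False by simp
  ultimately have "((\<lambda>t. of_real (pi - t) * cis (of_int m * t) + of_real (- 1) * ?F t + ?F t) has_integral
      (of_real (pi - 2*pi) * ?F (2*pi) - of_real (pi - 0) * ?F 0) + 0) {0..2*pi}"
    by (rule has_integral_add)
  moreover have "cis (of_int m * (2*pi)) = 1"
    using cis_multiple_2pi[of "of_int m"] by (simp add: mult_ac)
  moreover have "(of_real (pi - 2*pi) * (1 / (\<i> * of_int m)) - of_real (pi - 0) * (1 / (\<i> * of_int m)))
      = 2 * of_real pi * \<i> / of_int m"
    using False by (simp add: field_simps)
  ultimately show ?thesis by simp
qed

lemma cis_diff_mult: "cis (of_int (int i - int j) * t) = cis (real i * t) * cis (- (real j * t))"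
  by (simp add: cis_mult left_diff_distrib)

text \<open>
  Parseval's identity for trigonometric polynomials.
\<close>

lemma has_integral_norm_trig_sum:
  fixes u :: "nat \<Rightarrow> complex"
  assumes "finite A"
  shows "((\<lambda>t. (norm (\<Sum>i\<in>A. u i * cis (real i * t)))\<^sup>2) has_integral
           2 * pi * (\<Sum>i\<in>A. (norm (u i))\<^sup>2)) {0..2*pi}"
proof -
  have "((\<lambda>t. \<Sum>i\<in>A. \<Sum>j\<in>A. u i * cnj (u j) * cis (of_int (int i - int j) * t)) has_integral
     (\<Sum>i\<in>A. \<Sum>j\<in>A. u i * cnj (u j) * (if int i - int j = 0 then 2 * of_real pi else 0))) {0..2*pi}"
    using assms by (intro has_integral_sum has_integral_mult_right has_integral_cis_int)
  moreover have "(\<Sum>i\<in>A. \<Sum>j\<in>A. u i * cnj (u j) * (if int i - int j = 0 then 2 * of_real pi else 0))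
     = of_real (2 * pi * (\<Sum>i\<in>A. (norm (u i))\<^sup>2))"
    using assms by (simp add: if_distrib[of "\<lambda>x. _ * x"] sum_distrib_left complex_norm_square 
        flip: of_real_power cong: if_cong) (simp add: complex_norm_square mult_ac)
  moreover have "(\<Sum>i\<in>A. \<Sum>j\<in>A. u i * cnj (u j) * cis (of_int (int i - int j) * t))
     = of_real ((norm (\<Sum>i\<in>A. u i * cis (real i * t)))\<^sup>2)" for t
    unfolding complex_norm_square cnj_sum sum_product
    unfolding cis_diff_mult by (simp add: cis_cnj mult_ac)
  ultimately have "((\<lambda>t. Re (of_real ((norm (\<Sum>i\<in>A. u i * cis (real i * t)))\<^sup>2))) has_integral
      Re (of_real (2 * pi * (\<Sum>i\<in>A. (norm (u i))\<^sup>2)))) {0..2*pi}"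
    by (intro has_integral_Re) simp
  then show ?thesis by simp
qed

text \<open>
  The double sum is \<open>(1 / (2 \<pi> \<i>)) \<integral> (\<pi> - t) U(t) V(t) dt\<close> for trigonometric polynomials \<open>U\<close>
  and \<open>V\<close> with coefficients \<open>u\<close> and \<open>v\<close>. As \<open>\<bar>\<pi> - t\<bar> \<le> \<pi>\<close> and \<open>\<bar>U V\<bar> \<le> (\<bar>U\<bar>\<^sup>2 + \<bar>V\<bar>\<^sup>2) / 2\<close>, Parseval's
  identity bounds the integral. The diagonal terms vanish by \<open>z / 0 = 0\<close>.
\<close>

lemma hilbert_inequality:
  fixes u v :: "nat \<Rightarrow> complex"
  assumes A: "finite A" and u: "\<And>i. i \<in> A \<Longrightarrow> norm (u i) \<le> 1" and v: "\<And>j. j \<in> A \<Longrightarrow> norm (v j) \<le> 1"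
  shows "norm (\<Sum>i\<in>A. \<Sum>j\<in>A. u i * v j / of_int (int i - int j)) \<le> pi * card A"
proof -
  define U where "U t = (\<Sum>i\<in>A. u i * cis (real i * t))" for t
  define V where "V t = cnj (\<Sum>j\<in>A. cnj (v j) * cis (real j * t))" for t
  let ?S = "\<Sum>i\<in>A. \<Sum>j\<in>A. u i * v j / of_int (int i - int j)"
  have "((\<lambda>t. \<Sum>i\<in>A. \<Sum>j\<in>A. u i * v j * (of_real (pi - t) * cis (of_int (int i - int j) * t))) has_integral
      (\<Sum>i\<in>A. \<Sum>j\<in>A. u i * v j * (2 * of_real pi * \<i> / of_int (int i - int j)))) {0..2*pi}"
    using A by (intro has_integral_sum has_integral_mult_right has_integral_sawtooth_cis)
  moreover have "(\<Sum>i\<in>A. \<Sum>j\<in>A. u i * v j * (of_real (pi - t) * cis (of_int (int i - int j) * t)))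
     = of_real (pi - t) * (U t * V t)" for t
    unfolding U_def V_def cnj_sum sum_product unfolding sum_distrib_left
    unfolding cis_diff_mult by (simp add: cis_cnj mult_ac)
  moreover have "(\<Sum>i\<in>A. \<Sum>j\<in>A. u i * v j * (2 * of_real pi * \<i> / of_int (int i - int j)))
     = 2 * of_real pi * \<i> * ?S"
    by (simp add: sum_distrib_left mult_ac)
  ultimately have I: "((\<lambda>t. of_real (pi - t) * (U t * V t)) has_integral 2 * of_real pi * \<i> * ?S) {0..2*pi}"
    by simp
  have "((\<lambda>t. (norm (U t))\<^sup>2 + (norm (V t))\<^sup>2) has_integral
      2 * pi * (\<Sum>i\<in>A. (norm (u i))\<^sup>2) + 2 * pi * (\<Sum>i\<in>A. (norm (v i))\<^sup>2)) {0..2*pi}"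
    using has_integral_add[OF has_integral_norm_trig_sum[OF A, of u]
        has_integral_norm_trig_sum[OF A, of "\<lambda>j. cnj (v j)"]]
    unfolding U_def V_def complex_mod_cnj .
  from has_integral_mult_right[OF this, of "pi / 2"]
  have J: "((\<lambda>t. pi / 2 * ((norm (U t))\<^sup>2 + (norm (V t))\<^sup>2)) has_integral
      pi / 2 * (2 * pi * (\<Sum>i\<in>A. (norm (u i))\<^sup>2) + 2 * pi * (\<Sum>i\<in>A. (norm (v i))\<^sup>2))) {0..2*pi}"
    by simp
  have "norm (2 * of_real pi * \<i> * ?S)
      \<le> pi / 2 * (2 * pi * (\<Sum>i\<in>A. (norm (u i))\<^sup>2) + 2 * pi * (\<Sum>i\<in>A. (norm (v i))\<^sup>2))"
    unfolding integral_unique[OF I, symmetric] integral_unique[OF J, symmetric]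
  proof (rule integral_norm_bound_integral)
    show "(\<lambda>t. of_real (pi - t) * (U t * V t)) integrable_on {0..2*pi}" using I by blast
    show "(\<lambda>t. pi / 2 * ((norm (U t))\<^sup>2 + (norm (V t))\<^sup>2)) integrable_on {0..2*pi}" using J by blast
    fix t assume t: "t \<in> {0..2*pi}"
    have "norm (of_real (pi - t) * (U t * V t)) = \<bar>pi - t\<bar> * (norm (U t) * norm (V t))"
      by (simp add: norm_mult flip: of_real_diff)
    also have "\<dots> \<le> pi * (((norm (U t))\<^sup>2 + (norm (V t))\<^sup>2) / 2)"
      using t arith_geo_mean_sqrt[of "(norm (U t))\<^sup>2" "(norm (V t))\<^sup>2"]
      by (intro mult_mono) (auto simp: real_sqrt_mult)
    finally show "norm (of_real (pi - t) * (U t * V t)) \<le> pi / 2 * ((norm (U t))\<^sup>2 + (norm (V t))\<^sup>2)"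
      by simp
  qed
  also have "\<dots> \<le> pi / 2 * (2 * pi * (\<Sum>i\<in>A. 1) + 2 * pi * (\<Sum>i\<in>A. 1))"
    using u v by (intro mult_left_mono add_mono sum_mono power_le_one) auto
  finally have "2 * pi * norm ?S \<le> 2 * pi * (pi * card A)"
    by (simp add: norm_mult)
  then show ?thesis by simp
qed

section \<open>Functionals on integral projective tensor products\<close>

lemma linf_norm_upper: "x \<in> space M \<Longrightarrow> ennreal (norm (f x)) \<le> linf_norm M f"
  unfolding linf_norm_def by (rule SUP_upper)

lemma linf_norm_finite:
  assumes "f \<in> linf M"
  shows "linf_norm M f < \<infinity>"
proof -
  obtain B where "\<And>x. x \<in> space M \<Longrightarrow> norm (f x) \<le> B"
    using assms by (auto simp: linf_def bounded_iff)
  then have "linf_norm M f \<le> ennreal B"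
    unfolding linf_norm_def by (intro SUP_least ennreal_leI)
  then show ?thesis by (rule le_less_trans) simp
qed

text \<open>
  Dividing each factor by its norm reduces the estimate to the unit ball. A factor of norm 0 vanishes
  on the whole space, so the scaling identity survives the division by 0.
\<close>

lemma unit_ball_test_scaled:
  fixes M :: "'i \<Rightarrow> 'a measure" and c :: "'k \<Rightarrow> complex" and w :: "'k \<Rightarrow> 'i \<Rightarrow> 'a"
  assumes I: "finite I" and w: "\<And>k j. k \<in> J \<Longrightarrow> j \<in> I \<Longrightarrow> w k j \<in> space (M j)"
    and f: "\<And>j. j \<in> I \<Longrightarrow> f j \<in> linf (M j)"
    and test: "\<And>a. (\<And>j x. j \<in> I \<Longrightarrow> x \<in> space (M j) \<Longrightarrow> norm (a j x) \<le> 1) \<Longrightarrow>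
       norm (\<Sum>k\<in>J. c k * (\<Prod>j\<in>I. a j (w k j))) \<le> 1"
  shows "ennreal (norm (\<Sum>k\<in>J. c k * (\<Prod>j\<in>I. f j (w k j)))) \<le> (\<Prod>j\<in>I. linf_norm (M j) (f j))"
proof -
  define n where "n j = enn2real (linf_norm (M j) (f j))" for j
  have n: "ennreal (n j) = linf_norm (M j) (f j)" if "j \<in> I" for j
    unfolding n_def using linf_norm_finite[OF f[OF that]] by (auto simp: ennreal_enn2real)
  have n0: "n j \<ge> 0" for j by (simp add: n_def)
  have fn: "norm (f j x) \<le> n j" if "j \<in> I" "x \<in> space (M j)" for j x
    using linf_norm_upper[OF that(2), of "f j"] n0 unfolding n[OF that(1), symmetric] by simp
  define a where "a j x = f j x / of_real (n j)" for j x
  have fa: "f j x = of_real (n j) * a j x" if "j \<in> I" "x \<in> space (M j)" for j x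
    using fn[OF that] by (auto simp: a_def)
  have "norm (a j x) \<le> 1" if "j \<in> I" "x \<in> space (M j)" for j x
    using fn[OF that] n0[of j] by (auto simp: a_def norm_divide divide_le_eq_1)
  then have "norm (\<Sum>k\<in>J. c k * (\<Prod>j\<in>I. a j (w k j))) \<le> 1" by (rule test)
  moreover have "(\<Sum>k\<in>J. c k * (\<Prod>j\<in>I. f j (w k j)))
      = of_real (\<Prod>j\<in>I. n j) * (\<Sum>k\<in>J. c k * (\<Prod>j\<in>I. a j (w k j)))"
  proof -
    have "(\<Prod>j\<in>I. f j (w k j)) = of_real (\<Prod>j\<in>I. n j) * (\<Prod>j\<in>I. a j (w k j))" if "k \<in> J" for k
      unfolding of_real_prod prod.distrib[symmetric] using w[OF that] fa by (intro prod.cong) auto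
    then show ?thesis by (simp add: sum_distrib_left mult_ac)
  qed
  ultimately have "norm (\<Sum>k\<in>J. c k * (\<Prod>j\<in>I. f j (w k j))) \<le> (\<Prod>j\<in>I. n j)"
    using prod_nonneg[of I n] n0 by (simp add: norm_mult mult_left_le abs_prod del: of_real_prod)
  then have "ennreal (norm (\<Sum>k\<in>J. c k * (\<Prod>j\<in>I. f j (w k j)))) \<le> ennreal (\<Prod>j\<in>I. n j)"
    by (rule ennreal_leI)
  also have "\<dots> = (\<Prod>j\<in>I. linf_norm (M j) (f j))"
    using n n0 by (simp flip: prod_ennreal)
  finally show ?thesis .
qed

text \<open>
  The functional commutes with the integral of the decomposition, and the pointwise estimate
  applies to the integrand at every parameter \<open>s\<close>.
\<close>

lemma ipd_functional_bound:
  fixes M :: "'i \<Rightarrow> 'a measure" and c :: "'k \<Rightarrow> complex" and w :: "'k \<Rightarrow> 'i \<Rightarrow> 'a"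
  assumes ipd: "is_ipd I M F S p" and I: "finite I" and J: "finite J"
    and w: "\<And>k. k \<in> J \<Longrightarrow> w k \<in> space (Pi\<^sub>M I M)"
    and test: "\<And>a. (\<And>j x. j \<in> I \<Longrightarrow> x \<in> space (M j) \<Longrightarrow> norm (a j x) \<le> 1) \<Longrightarrow>
       norm (\<Sum>k\<in>J. c k * (\<Prod>j\<in>I. a j (w k j))) \<le> 1"
  shows "ennreal (norm (\<Sum>k\<in>J. c k * F (w k))) \<le> ipd_cost I M S p"
proof -
  define N where "N s = (\<Prod>j\<in>I. linf_norm (M j) (\<lambda>x. p j x s))" for s
  define P where "P k s = (\<Prod>j\<in>I. p j (w k j) s)" for k s
  have cost: "ipd_cost I M S p = (\<integral>\<^sup>+ s. N s \<partial>S)" "(\<integral>\<^sup>+ s. N s \<partial>S) < \<infinity>"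
    using ipd by (simp_all add: ipd_cost_def N_def nn_integral_completion is_ipd_def)
  have wI: "w k j \<in> space (M j)" if "k \<in> J" "j \<in> I" for k j
    using w[OF that(1)] that(2) by (auto simp: space_PiM)
  have linf: "(\<lambda>x. p j x s) \<in> linf (M j)" if "j \<in> I" "s \<in> space S" for j s
    using ipd that by (auto simp: is_ipd_def)
  have meas: "P k \<in> borel_measurable S" if "k \<in> J" for k
    unfolding P_def
  proof (rule borel_measurable_prod)
    fix j assume j: "j \<in> I"
    have "(\<lambda>(x, s). p j x s) \<in> borel_measurable (M j \<Otimes>\<^sub>M S)"
      using ipd j by (auto simp: is_ipd_def)
    from measurable_compose[OF measurable_Pair1'[OF wI[OF that j]] this]
    show "p j (w k j) \<in> borel_measurable S" by simp
  qed
  have int: "integrable S (P k)" if k: "k \<in> J" for k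
  proof (rule integrableI_bounded[OF meas[OF k]])
    have "(\<integral>\<^sup>+ s. ennreal (norm (P k s)) \<partial>S) \<le> (\<integral>\<^sup>+ s. N s \<partial>S)"
    proof (rule nn_integral_mono)
      fix s assume s: "s \<in> space S"
      have "norm (\<Sum>k\<in>{k}. 1 * (\<Prod>j\<in>I. a j (w k j))) \<le> 1"
        if "\<And>j x. j \<in> I \<Longrightarrow> x \<in> space (M j) \<Longrightarrow> norm (a j x) \<le> 1" for a :: "'i \<Rightarrow> 'a \<Rightarrow> complex"
        using wI[OF k] that by (auto simp flip: prod_norm intro!: prod_le_1)
      then have "ennreal (norm (\<Sum>k\<in>{k}. 1 * (\<Prod>j\<in>I. p j (w k j) s))) \<le> N s"
        unfolding N_def using wI k linf s
        by (intro unit_ball_test_scaled[where c="\<lambda>_. 1" and f="\<lambda>j x. p j x s"] I) auto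
      then show "ennreal (norm (P k s)) \<le> N s" by (simp add: P_def)
    qed
    with cost show "(\<integral>\<^sup>+ s. ennreal (norm (P k s)) \<partial>S) < \<infinity>" by (simp add: le_less_trans)
  qed
  have "(\<Sum>k\<in>J. c k * F (w k)) = (\<integral>s. (\<Sum>k\<in>J. c k * P k s) \<partial>S)"
    using ipd w int by (simp add: is_ipd_def P_def[abs_def])
  also have "ennreal (norm \<dots>) \<le> (\<integral>\<^sup>+ s. ennreal (norm (\<Sum>k\<in>J. c k * P k s)) \<partial>S)"
    using int by (intro integral_norm_bound_ennreal) auto
  also have "\<dots> \<le> (\<integral>\<^sup>+ s. N s \<partial>S)"
    unfolding P_def N_def
    by (intro nn_integral_mono unit_ball_test_scaled I wI linf test)
  finally show ?thesis using cost by simp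
qed

lemma iptp_functional_bound:
  fixes T :: "'s itself" and M :: "'i \<Rightarrow> 'a measure" and c :: "'k \<Rightarrow> complex" and w :: "'k \<Rightarrow> 'i \<Rightarrow> 'a"
  assumes "finite I" "finite J"
    and "\<And>k. k \<in> J \<Longrightarrow> w k \<in> space (Pi\<^sub>M I M)"
    and "\<And>a. (\<And>j x. j \<in> I \<Longrightarrow> x \<in> space (M j) \<Longrightarrow> norm (a j x) \<le> 1) \<Longrightarrow>
       norm (\<Sum>k\<in>J. c k * (\<Prod>j\<in>I. a j (w k j))) \<le> 1"
  shows "ennreal (norm (\<Sum>k\<in>J. c k * F (w k))) \<le> iptp_norm T I M F"
  unfolding iptp_norm_def
proof (rule Inf_greatest)
  fix x assume "x \<in> {ipd_cost I M S p |(S :: 's measure) p. is_ipd I M F S p}"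
  then obtain S :: "'s measure" and p where p: "is_ipd I M F S p" "x = ipd_cost I M S p" by blast
  show "ennreal (norm (\<Sum>k\<in>J. c k * F (w k))) \<le> x"
    unfolding p(2) by (rule ipd_functional_bound[OF p(1) assms(1,2)]) (fact assms(3,4))+
qed

text \<open>
  The integral projective norm dominates the supremum norm, since a point evaluation is bounded by 1
  on products of functions bounded by 1.
\<close>

lemma iptp_norm_ge_value:
  fixes M :: "'a \<Rightarrow> 'b measure"
  assumes "finite I" "w \<in> space (Pi\<^sub>M I M)"
  shows "ennreal (norm (F w)) \<le> iptp_norm T I M F"
proof -
  have "norm (\<Sum>k\<in>{()}. 1 * (\<Prod>j\<in>I. a j (w j))) \<le> 1"
    if "\<And>j x. j \<in> I \<Longrightarrow> x \<in> space (M j) \<Longrightarrow> norm (a j x) \<le> 1" for a :: "'a \<Rightarrow> 'b \<Rightarrow> complex"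
    using assms that by (auto simp: space_PiM PiE_mem simp flip: prod_norm intro!: prod_le_1)
  then have "ennreal (norm (\<Sum>k\<in>{()}. 1 * F w)) \<le> iptp_norm T I M F"
    using assms by (intro iptp_functional_bound[where c="\<lambda>_. 1" and w="\<lambda>_. w"]) auto
  then show ?thesis by simp
qed

lemma iptp_converges_pointwise:
  assumes "iptp_converges T I M G F" "finite I" "w \<in> space (Pi\<^sub>M I M)"
  shows "(\<lambda>n. G n w) \<longlonglongrightarrow> F w"
proof -
  have "(\<lambda>n. ennreal (norm (G n w - F w))) \<longlonglongrightarrow> 0"
  proof (rule tendsto_sandwich[OF _ _ tendsto_const])
    show "(\<lambda>n. iptp_norm T I M (\<lambda>w. G n w - F w)) \<longlonglongrightarrow> 0"
      using assms by (simp add: iptp_converges_def)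
  qed (auto intro!: always_eventually iptp_norm_ge_value[OF assms(2,3), of "\<lambda>w. G _ w - F w"])
  then have "(\<lambda>n. norm (G n w - F w)) \<longlonglongrightarrow> 0"
    by (subst tendsto_ennreal_iff[symmetric]) auto
  then show ?thesis by (simp add: LIM_zero_iff tendsto_norm_zero_iff)
qed

section \<open>Divided differences\<close>

lemma divdiff_cong:
  "(\<And>i. i \<le> j \<Longrightarrow> l i = l' i) \<Longrightarrow> divdiff f j l = divdiff f j l'"
proof (induction j arbitrary: l l')
  case (Suc j)
  have "divdiff f j l = divdiff f j l'" using Suc.prems by (intro Suc.IH) auto
  moreover have "divdiff f j (l(j := l (Suc j))) = divdiff f j (l'(j := l' (Suc j)))"
    using Suc.prems by (intro Suc.IH) auto
  ultimately show ?case using Suc.prems by simp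
qed simp

lemma divdiff_add: "divdiff (\<lambda>x. f x + g x) j l = divdiff f j l + divdiff g j l"
  by (induction j arbitrary: l) (simp_all add: add_divide_distrib diff_divide_distrib)

lemma divdiff_const: "divdiff (\<lambda>_. c) j l = (if j = 0 then c else 0)"
  by (induction j arbitrary: l) auto

text \<open>
  The Leibniz rule for multiplication by the variable. The induction applies its hypothesis to both
  tuples that occur in the recursion; their first entries agree, so the lower-order terms cancel.
\<close>

lemma divdiff_ident_mult:
  assumes "inj_on l {..Suc j}"
  shows "divdiff (\<lambda>x. of_real x * g x) (Suc j) l
       = of_real (l (Suc j)) * divdiff g (Suc j) l + divdiff g j l"
  using assms
proof (induction j arbitrary: l)
  case 0
  have "l 0 \<noteq> l (Suc 0)" using 0 by (auto dest!: inj_onD[where x=0 and y="Suc 0"])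
  then have "complex_of_real (l 0 - l (Suc 0)) \<noteq> 0" by simp
  then show ?case by (simp add: field_simps)
next
  case (Suc j)
  let ?f = "\<lambda>x. of_real x * g x"
  define a b l' where "a = l (Suc j)" and "b = l (Suc (Suc j))" and "l' = l(Suc j := b)"
  have ab: "a \<noteq> b" using inj_onD[OF Suc.prems, of "Suc j" "Suc (Suc j)"] by (auto simp: a_def b_def)
  have i1: "inj_on l {..Suc j}" by (rule inj_on_subset[OF Suc.prems]) auto
  have i2: "inj_on l' {..Suc j}"
  proof (rule inj_onI)
    fix x y assume xy: "x \<in> {..Suc j}" "y \<in> {..Suc j}" "l' x = l' y"
    define s where "s x = (if x = Suc j then Suc (Suc j) else x)" for x
    have "l' x = l (s x)" "l' y = l (s y)" by (simp_all add: l'_def s_def b_def)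
    with xy have "s x = s y" by (intro inj_onD[OF Suc.prems]) (auto simp: s_def)
    then show "x = y" using xy by (auto simp: s_def split: if_splits)
  qed
  have c: "divdiff g j l' = divdiff g j l" by (rule divdiff_cong) (simp add: l'_def)
  have D: "divdiff g (Suc (Suc j)) l = (divdiff g (Suc j) l - divdiff g (Suc j) l') / of_real (a - b)" for g
    by (simp only: divdiff.simps(2)[of _ "Suc j"] a_def b_def l'_def)
  have alg: "(of_real a * X + Z - (of_real b * Y + Z)) / of_real (a - b)
      = of_real b * ((X - Y) / of_real (a - b)) + X" for X Y Z :: complex
  proof -
    define d where "d = complex_of_real (a - b)"
    have "d \<noteq> 0" "complex_of_real a = of_real b + d" using ab by (simp_all add: d_def)
    then show ?thesis unfolding d_def[symmetric] by (simp add: field_simps)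
  qed
  have i1': "divdiff ?f (Suc j) l = of_real a * divdiff g (Suc j) l + divdiff g j l"
    using Suc.IH[OF i1] unfolding a_def .
  have "l' (Suc j) = b" by (simp add: l'_def)
  then have i2': "divdiff ?f (Suc j) l' = of_real b * divdiff g (Suc j) l' + divdiff g j l"
    using Suc.IH[OF i2] unfolding c by (simp only:)
  show ?case unfolding D[of ?f] D[of g] i1' i2' alg unfolding b_def ..
qed

text \<open>
  By induction on the polynomial: the Leibniz rule for \<open>a + x p(x)\<close> expresses the extension through
  the extensions for \<open>p\<close>.
\<close>

lemma poly_divdiff_continuous_extension:
  "\<exists>E. continuous_on UNIV E \<and>
      (\<forall>l. inj_on l {..j} \<longrightarrow> E l = divdiff (\<lambda>x. poly q (of_real x)) j l)"
proof (induction q arbitrary: j rule: pCons_induct)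
  case 0
  show ?case by (intro exI[of _ "\<lambda>_. 0"]) (simp add: divdiff_const)
next
  case (pCons a p)
  obtain E where E: "\<And>j. continuous_on UNIV (E j)"
    "\<And>j l. inj_on l {..j} \<Longrightarrow> E j l = divdiff (\<lambda>x. poly p (of_real x)) j l"
    using pCons.IH by metis
  show ?case
  proof (cases j)
    case 0
    show ?thesis unfolding 0
      by (rule exI[of _ "\<lambda>l. a + of_real (l 0) * E 0 l"])
        (auto intro!: continuous_intros E simp: E(2))
  next
    case (Suc i)
    let ?G = "\<lambda>l. of_real (l (Suc i)) * E (Suc i) l + E i l"
    have "?G l = divdiff (\<lambda>x. poly (pCons a p) (of_real x)) (Suc i) l" if "inj_on l {..Suc i}" for l
    proof -
      have "inj_on l {..i}" by (rule inj_on_subset[OF that]) auto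
      then show ?thesis
        using divdiff_ident_mult[OF that, of "\<lambda>x. poly p (of_real x)"] that
        by (simp only: poly_pCons divdiff_add divdiff_const E(2)) simp
    qed
    then show ?thesis unfolding Suc
      by (intro exI[of _ ?G]) (auto intro!: continuous_intros E)
  qed
qed

text \<open>
  Tuples with distinct entries are dense: on the line \<open>t \<mapsto> (l\<^sub>i + t i)\<^sub>i\<close> all but finitely many
  points have distinct entries.
\<close>

lemma continuous_eq_of_eq_at_distinct:
  fixes g g' :: "(nat \<Rightarrow> real) \<Rightarrow> complex"
  assumes "continuous_on ({..j} \<rightarrow>\<^sub>E UNIV) g" "continuous_on ({..j} \<rightarrow>\<^sub>E UNIV) g'"
    and eq: "\<And>l. l \<in> {..j} \<rightarrow>\<^sub>E UNIV \<Longrightarrow> inj_on l {..j} \<Longrightarrow> g l = g' l"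
    and l: "l \<in> {..j} \<rightarrow>\<^sub>E UNIV"
  shows "g l = g' l"
proof -
  define \<gamma> where "\<gamma> t = (\<lambda>i. if i \<le> j then l i + t * real i else undefined)" for t
  have \<gamma>: "\<gamma> t \<in> {..j} \<rightarrow>\<^sub>E UNIV" for t by (simp add: \<gamma>_def PiE_def extensional_def)
  have "continuous_on UNIV (\<lambda>t. \<gamma> t i)" for i
    unfolding \<gamma>_def by (cases "i \<le> j") (auto intro!: continuous_intros)
  then have c\<gamma>: "continuous_on UNIV \<gamma>" by (rule continuous_on_coordinatewise_then_product)
  have \<gamma>0: "\<gamma> 0 = l" using l by (auto simp: \<gamma>_def PiE_def extensional_def fun_eq_iff)
  have "continuous_on UNIV (\<lambda>t. g (\<gamma> t) - g' (\<gamma> t))"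
    using \<gamma> by (intro continuous_on_diff continuous_on_compose2[OF assms(1) c\<gamma>]
        continuous_on_compose2[OF assms(2) c\<gamma>]) auto
  then have lim: "((\<lambda>t. g (\<gamma> t) - g' (\<gamma> t)) \<longlongrightarrow> g l - g' l) (at 0)"
    using \<gamma>0 by (auto simp: continuous_on_eq_continuous_at isCont_def)
  \<comment> \<open>The parameters at which two entries of the moved tuple can coincide.\<close>
  define B where "B = (\<lambda>(a, b). (l a - l b) / (real b - real a)) ` ({..j} \<times> {..j})"
  have "finite B" by (simp add: B_def)
  have inj: "inj_on (\<gamma> t) {..j}" if "t \<notin> B" for t
  proof (rule inj_onI, rule ccontr)
    fix a b assume ab: "a \<in> {..j}" "b \<in> {..j}" "\<gamma> t a = \<gamma> t b" "a \<noteq> b"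
    then have "t = (l a - l b) / (real b - real a)" by (simp add: \<gamma>_def field_simps)
    then show False using that ab by (auto simp: B_def)
  qed
  have "\<forall>\<^sub>F t in at 0. t \<in> - (B - {0}) - {0}"
    using \<open>finite B\<close> by (intro eventually_at_in_open open_Compl finite_imp_closed) auto
  then have "\<forall>\<^sub>F t in at 0. g (\<gamma> t) - g' (\<gamma> t) = 0"
  proof eventually_elim
    case (elim t)
    then have "t \<notin> B" by auto
    then show ?case using eq[OF \<gamma> inj] by simp
  qed
  then have "((\<lambda>t. g (\<gamma> t) - g' (\<gamma> t)) \<longlongrightarrow> 0) (at 0)" by (rule tendsto_eventually)
  from tendsto_unique[OF _ lim this] show ?thesis by simp
qed

lemma divdiff_ext_eq:
  assumes E: "continuous_on ({..j} \<rightarrow>\<^sub>E UNIV) E"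
    "\<And>l. l \<in> {..j} \<rightarrow>\<^sub>E UNIV \<Longrightarrow> inj_on l {..j} \<Longrightarrow> E l = divdiff f j l"
    and l: "l \<in> {..j} \<rightarrow>\<^sub>E UNIV"
  shows "divdiff_ext f j l = E l"
proof -
  let ?D = "{..j} \<rightarrow>\<^sub>E (UNIV :: real set)"
  have "divdiff_ext f j = restrict E ?D"
    unfolding divdiff_ext_def
  proof (rule the_equality)
    show "restrict E ?D \<in> extensional ?D \<and> continuous_on ?D (restrict E ?D) \<and>
      (\<forall>l\<in>?D. inj_on l {..j} \<longrightarrow> restrict E ?D l = divdiff f j l)"
      using E by (auto cong: continuous_on_cong)
    fix g assume g: "g \<in> extensional ?D \<and> continuous_on ?D g \<and>
      (\<forall>l\<in>?D. inj_on l {..j} \<longrightarrow> g l = divdiff f j l)"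
    show "g = restrict E ?D"
    proof (rule extensionalityI)
      show "g \<in> extensional ?D" "restrict E ?D \<in> extensional ?D" using g by auto
      fix x assume x: "x \<in> ?D"
      have "g x = E x"
        by (rule continuous_eq_of_eq_at_distinct[OF _ E(1) _ x]) (use g E(2) in auto)
      then show "g x = restrict E ?D x" using x by simp
    qed
  qed
  then show ?thesis using l by simp
qed

text \<open>
  A divided difference is a fixed linear combination of point values.
\<close>

lemma divdiff_tendsto:
  assumes "\<And>i. i \<le> j \<Longrightarrow> (\<lambda>n. f n (l i)) \<longlonglongrightarrow> g (l i)"
  shows "(\<lambda>n. divdiff (f n) j l) \<longlonglongrightarrow> divdiff g j l"
  using assms
proof (induction j arbitrary: l)
  case (Suc j)
  have a: "(\<lambda>n. divdiff (f n) j l) \<longlonglongrightarrow> divdiff g j l"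
    "(\<lambda>n. divdiff (f n) j (l(j := l (Suc j)))) \<longlonglongrightarrow> divdiff g j (l(j := l (Suc j)))"
    using Suc.prems by (intro Suc.IH; simp)+
  show ?case unfolding divdiff.simps divide_inverse by (intro tendsto_intros a)
qed simp

text \<open>
  The case \<open>j = 0\<close> of the convergence shows that \<open>q n\<close> tends to \<open>f\<close> pointwise, hence its divided
  differences at distinct points tend to those of \<open>f\<close>; the case \<open>j = k\<close> shows that they tend to the
  extension.
\<close>

lemma NCk_divdiff_ext_at_distinct:
  assumes conv: "\<And>j. j \<le> k \<Longrightarrow> iptp_converges T {..j} (\<lambda>_. restrict_space borel {-r..r})
       (\<lambda>n. divdiff_ext (\<lambda>x. poly (q n) (of_real x)) j) (divdiff_ext f j)"
    and f: "continuous_on UNIV f"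
    and l: "l \<in> {..k} \<rightarrow>\<^sub>E {-r..r}" "inj_on l {..k}"
  shows "divdiff_ext f k l = divdiff f k l"
proof -
  let ?q = "\<lambda>n x. poly (q n) (complex_of_real x)"
  have sp: "space (Pi\<^sub>M {..j} (\<lambda>_. restrict_space borel {-r..r})) = {..j} \<rightarrow>\<^sub>E {-r..r}" for j :: nat
    by (simp add: space_PiM space_restrict_space)
  have q: "divdiff_ext (?q n) j l = divdiff (?q n) j l"
    if l: "l \<in> {..j} \<rightarrow>\<^sub>E UNIV" "inj_on l {..j}" for n j l
  proof -
    obtain E where E: "continuous_on UNIV E" "\<And>l. inj_on l {..j} \<Longrightarrow> E l = divdiff (?q n) j l"
      using poly_divdiff_continuous_extension[of j "q n"] by auto
    from divdiff_ext_eq[OF continuous_on_subset[OF E(1)] E(2) l(1)] E(2)[OF l(2)] show ?thesis by simp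
  qed
  have pt: "(\<lambda>n. ?q n x) \<longlonglongrightarrow> f x" if x: "x \<in> {-r..r}" for x
  proof -
    define w where "w = (\<lambda>i. if i = (0::nat) then x else undefined)"
    have w: "w \<in> {..0} \<rightarrow>\<^sub>E {-r..r}" "w 0 = x" using x by (simp_all add: w_def PiE_def extensional_def)
    then have w': "w \<in> {..0} \<rightarrow>\<^sub>E UNIV" "inj_on w {..0}" by auto
    have "continuous_on ({..0} \<rightarrow>\<^sub>E UNIV) (\<lambda>l. f (l (0::nat)))"
      by (intro continuous_on_subset[OF continuous_on_compose2[OF f continuous_on_product_coordinates]]) auto
    from divdiff_ext_eq[OF this _ w'(1), of f] have "divdiff_ext f 0 w = f x" using w by simp
    moreover have "divdiff_ext (?q n) 0 w = ?q n x" for n using q[OF w'] w by simp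
    ultimately show ?thesis
      using iptp_converges_pointwise[OF conv[of 0], of w] w unfolding sp by simp
  qed
  have "(\<lambda>n. divdiff_ext (?q n) k l) \<longlonglongrightarrow> divdiff_ext f k l"
    using iptp_converges_pointwise[OF conv[of k], of l] l unfolding sp by simp
  moreover have "divdiff_ext (?q n) k l = divdiff (?q n) k l" for n using l by (intro q) auto
  moreover have "(\<lambda>n. divdiff (?q n) k l) \<longlonglongrightarrow> divdiff f k l"
    using l by (intro divdiff_tendsto pt) auto
  ultimately show ?thesis using LIMSEQ_unique by simp
qed

lemma NCk_divdiff_bounded:
  fixes T :: "'s itself" and c :: "'k \<Rightarrow> complex" and w :: "'k \<Rightarrow> nat \<Rightarrow> real"
  assumes f: "f \<in> NCk T k" and fc: "continuous_on UNIV f" and r: "r > 0"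
    and J: "finite J" and w: "\<And>p i. p \<in> J \<Longrightarrow> i \<le> k \<Longrightarrow> \<bar>w p i\<bar> \<le> r"
    and inj: "\<And>p. p \<in> J \<Longrightarrow> inj_on (w p) {..k}"
    and test: "\<And>a. (\<And>i x. i \<le> k \<Longrightarrow> norm (a i x) \<le> 1) \<Longrightarrow>
      norm (\<Sum>p\<in>J. c p * (\<Prod>i\<le>k. a i (w p i))) \<le> 1"
  shows "norm (\<Sum>p\<in>J. c p * divdiff f k (w p))
    \<le> enn2real (iptp_norm T {..k} (\<lambda>_. restrict_space borel {-r..r}) (divdiff_ext f k))" (is "_ \<le> ?C")
proof -
  let ?M = "\<lambda>_::nat. restrict_space (borel :: real measure) {-r..r}"
  obtain q where conv: "\<And>j. j \<le> k \<Longrightarrow> iptp_converges T {..j} ?M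
       (\<lambda>n. divdiff_ext (\<lambda>x. poly (q n) (of_real x)) j) (divdiff_ext f j)"
    using f r unfolding NCk_def by blast
  have sp: "space (Pi\<^sub>M {..j} ?M) = {..j} \<rightarrow>\<^sub>E {-r..r}" "space (?M i) = {-r..r}" for j i :: nat
    by (simp_all add: space_PiM space_restrict_space)
  have "iptp_norm T {..k} ?M (divdiff_ext f k) < \<infinity>"
    using conv[of k] by (simp add: iptp_converges_def iptp_def)
  then have C: "iptp_norm T {..k} ?M (divdiff_ext f k) = ennreal ?C" "?C \<ge> 0"
    by (auto simp: ennreal_enn2real)
  define w' where "w' p = restrict (w p) {..k}" for p
  have w': "w' p \<in> {..k} \<rightarrow>\<^sub>E {-r..r}" "inj_on (w' p) {..k}" if "p \<in> J" for p
    using w[OF that] inj[OF that] by (force simp: w'_def abs_le_iff, simp add: w'_def inj_on_def)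
  have "ennreal (norm (\<Sum>p\<in>J. c p * divdiff_ext f k (w' p))) \<le> iptp_norm T {..k} ?M (divdiff_ext f k)"
  proof (rule iptp_functional_bound[OF _ J])
    show "w' p \<in> space (Pi\<^sub>M {..k} ?M)" if "p \<in> J" for p using w'[OF that] unfolding sp by blast
    fix a :: "nat \<Rightarrow> real \<Rightarrow> complex"
    assume a: "\<And>j x. j \<in> {..k} \<Longrightarrow> x \<in> space (?M j) \<Longrightarrow> norm (a j x) \<le> 1"
    \<comment> \<open>The hypothesis is about functions on the whole line, so \<open>a\<close> is extended by 0.\<close>
    define b where "b j x = (if x \<in> {-r..r} then a j x else 0)" for j x
    have "norm (\<Sum>p\<in>J. c p * (\<Prod>i\<le>k. b i (w p i))) \<le> 1"
      by (rule test) (use a in \<open>auto simp: b_def sp\<close>)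
    moreover have "(\<Prod>i\<le>k. b i (w p i)) = (\<Prod>i\<le>k. a i (w' p i))" if "p \<in> J" for p
      using w[OF that] by (intro prod.cong) (auto simp: b_def w'_def abs_le_iff minus_le_iff)
    ultimately show "norm (\<Sum>p\<in>J. c p * (\<Prod>i\<le>k. a i (w' p i))) \<le> 1" by simp
  qed simp
  from ord_le_eq_trans[OF this C(1)]
  have "norm (\<Sum>p\<in>J. c p * divdiff_ext f k (w' p)) \<le> ?C"
    unfolding ennreal_le_iff[OF C(2)] .
  moreover have "divdiff_ext f k (w' p) = divdiff f k (w p)" if "p \<in> J" for p
  proof -
    have "divdiff_ext f k (w' p) = divdiff f k (w' p)"
      by (rule NCk_divdiff_ext_at_distinct[OF conv fc w'[OF that]])
    also have "\<dots> = divdiff f k (w p)" by (rule divdiff_cong) (simp add: w'_def)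
    finally show ?thesis .
  qed
  ultimately show ?thesis by simp
qed

section \<open>Reduction to the first divided difference\<close>

definition node_tuple :: "real \<Rightarrow> real \<Rightarrow> (nat \<Rightarrow> real) \<Rightarrow> nat \<Rightarrow> real" where
  "node_tuple a b z i = (if i = 0 then a else if i = 1 then b else z i)"

text \<open>
  Nodes for the arguments with index at least 2, to be combined with any pair from \<open>P\<close>. They avoid
  the entries of the pairs, so that the combined tuples have distinct entries, and they avoid 0, so
  that a further node can be added that tends to 0.
\<close>

definition admissible :: "(real \<times> real) set \<Rightarrow> nat \<Rightarrow> (nat \<Rightarrow> real) \<Rightarrow> bool" where
  "admissible P k z \<longleftrightarrow> inj_on z {2..k} \<and>
     (\<forall>i\<in>{2..k}. z i \<noteq> 0 \<and> \<bar>z i\<bar> \<le> 1 \<and> z i \<notin> fst ` P \<union> snd ` P)"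

lemma inj_on_node_tuple:
  assumes "admissible P k z" "(a, b) \<in> P" "a \<noteq> b"
  shows "inj_on (node_tuple a b z) {..k}"
proof (rule inj_onI)
  fix x y assume xy: "x \<in> {..k}" "y \<in> {..k}" "node_tuple a b z x = node_tuple a b z y"
  have z: "z i \<noteq> a" "z i \<noteq> b" if "i \<le> k" "i \<noteq> 0" "i \<noteq> 1" for i
    using assms that by (force simp: admissible_def)+
  have inj: "x = y" if "x \<noteq> 0" "x \<noteq> 1" "y \<noteq> 0" "y \<noteq> 1" "z x = z y"
    using assms(1) that xy by (auto simp: admissible_def inj_on_def)
  show "x = y"
    using xy z[of x] z[of y] inj assms(3) by (auto simp: node_tuple_def split: if_splits dest: sym)
qed

text \<open>
  As long as \<open>t\<close> avoids the other nodes, none of the denominators that contain the moving node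
  vanishes.
\<close>

lemma isCont_divdiff_last:
  assumes "isCont g t" "\<And>i. i < j \<Longrightarrow> l i \<noteq> t"
  shows "isCont (\<lambda>t. divdiff g j (l(j := t))) t"
  using assms(2)
proof (induction j arbitrary: l)
  case 0
  then show ?case using assms(1) by simp
next
  case (Suc j)
  have e: "divdiff g (Suc j) (l(Suc j := t)) = (divdiff g j l - divdiff g j (l(j := t))) / of_real (l j - t)" for t
  proof -
    have "divdiff g j (l(Suc j := t)) = divdiff g j l"
      "divdiff g j (l(Suc j := t, j := t)) = divdiff g j (l(j := t))"
      by (rule divdiff_cong, simp)+
    then show ?thesis by simp
  qed
  have "isCont (\<lambda>t. divdiff g j (l(j := t))) t" by (rule Suc.IH) (use Suc.prems in auto)
  moreover have "complex_of_real (l j - t) \<noteq> 0" using Suc.prems[of j] by simp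
  ultimately show ?case unfolding e by (intro continuous_intros)
qed

text \<open>
  Let the last node \<open>t\<close> tend to 0 in the Leibniz rule
  \<open>(x g)\<^sup>[\<^sup>k\<^sup>+\<^sup>1\<^sup>](\<dots>, t) = t g\<^sup>[\<^sup>k\<^sup>+\<^sup>1\<^sup>](\<dots>, t) + g\<^sup>[\<^sup>k\<^sup>](\<dots>)\<close>. The first summand tends to 0 because the
  other nodes are nonzero, which keeps its divided difference bounded.
\<close>

lemma divdiff_bound_drop_power:
  fixes g :: "real \<Rightarrow> complex"
  assumes P: "finite P" "\<And>a b. (a, b) \<in> P \<Longrightarrow> a \<noteq> b \<and> a \<noteq> 0 \<and> b \<noteq> 0"
    and k: "k \<ge> 1" and g: "isCont g 0"
    and bound: "\<And>z. admissible P (Suc k) z \<Longrightarrow>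
       norm (\<Sum>(a, b)\<in>P. c (a, b) * divdiff (\<lambda>x. of_real x * g x) (Suc k) (node_tuple a b z)) \<le> B"
    and z: "admissible P k z"
  shows "norm (\<Sum>(a, b)\<in>P. c (a, b) * divdiff g k (node_tuple a b z)) \<le> B"
proof -
  define G where "G t = (\<Sum>(a, b)\<in>P. c (a, b) *
      (of_real t * divdiff g (Suc k) ((node_tuple a b z)(Suc k := t)) + divdiff g k (node_tuple a b z)))" for t
  have "isCont G 0"
    unfolding G_def case_prod_unfold
  proof (intro continuous_intros)
    fix p assume p: "p \<in> P"
    show "isCont (\<lambda>t. divdiff g (Suc k) ((node_tuple (fst p) (snd p) z)(Suc k := t))) 0"
    proof (rule isCont_divdiff_last[OF g])
      show "node_tuple (fst p) (snd p) z i \<noteq> 0" if "i < Suc k" for i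
        using P(2)[of "fst p" "snd p"] p z that by (auto simp: node_tuple_def admissible_def)
    qed
  qed
  then have "((\<lambda>t. norm (G t)) \<longlongrightarrow> norm (G 0)) (at 0)"
    by (intro tendsto_norm) (simp add: isCont_def)
  moreover have "\<forall>\<^sub>F t in at 0. norm (G t) \<le> B"
  proof -
    define X where "X = (fst ` P \<union> snd ` P \<union> z ` {2..k}) - {0}"
    have "finite X" using P by (simp add: X_def)
    then have "\<forall>\<^sub>F t in at 0. t \<in> (- X \<inter> {-1<..<1}) - {0}"
      by (intro eventually_at_in_open open_Int open_Compl finite_imp_closed) (auto simp: X_def)
    then show ?thesis
    proof eventually_elim
      case (elim t)
      then have t: "t \<noteq> 0" "\<bar>t\<bar> \<le> 1" "t \<notin> fst ` P" "t \<notin> snd ` P" "t \<notin> z ` {2..k}"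
        by (auto simp: X_def abs_le_iff)
      define z' where "z' = z(Suc k := t)"
      have adm: "admissible P (Suc k) z'"
      proof -
        have s: "{2..Suc k} = insert (Suc k) {2..k}" using k by auto
        have "inj_on z' {2..Suc k}"
          unfolding s z'_def using z t by (auto simp: admissible_def inj_on_def)
        then show ?thesis using z t unfolding admissible_def s by (auto simp: z'_def)
      qed
      have n: "node_tuple a b z' = (node_tuple a b z)(Suc k := t)" for a b
        using k by (auto simp: node_tuple_def z'_def fun_eq_iff)
      have "divdiff (\<lambda>x. of_real x * g x) (Suc k) (node_tuple a b z')
          = of_real t * divdiff g (Suc k) ((node_tuple a b z)(Suc k := t)) + divdiff g k (node_tuple a b z)"
        if "(a, b) \<in> P" for a b
      proof -
        have "inj_on (node_tuple a b z') {..Suc k}"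
          by (rule inj_on_node_tuple[OF adm that]) (use P(2) that in auto)
        from divdiff_ident_mult[OF this] have
          "divdiff (\<lambda>x. of_real x * g x) (Suc k) (node_tuple a b z')
          = of_real t * divdiff g (Suc k) (node_tuple a b z') + divdiff g k (node_tuple a b z')"
          unfolding n by (simp only: fun_upd_same)
        moreover have "divdiff g k (node_tuple a b z') = divdiff g k (node_tuple a b z)"
          by (rule divdiff_cong) (simp add: n)
        ultimately show ?thesis by (simp only: n)
      qed
      then have "(\<Sum>(a, b)\<in>P. c (a, b) * divdiff (\<lambda>x. of_real x * g x) (Suc k) (node_tuple a b z')) = G t"
        unfolding G_def by (intro sum.cong refl) (auto simp del: divdiff.simps)
      with bound[OF adm] show ?case by simp
    qed
  qed
  ultimately have "norm (G 0) \<le> B" by (rule tendsto_upperbound) simp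
  then show ?thesis by (simp add: G_def)
qed

lemma divdiff_bound_drop_powers:
  fixes h :: "real \<Rightarrow> complex"
  assumes P: "finite P" "\<And>a b. (a, b) \<in> P \<Longrightarrow> a \<noteq> b \<and> a \<noteq> 0 \<and> b \<noteq> 0"
    and h: "isCont h 0"
    and bound: "\<And>z. admissible P (Suc m) z \<Longrightarrow>
       norm (\<Sum>(a, b)\<in>P. c (a, b) * divdiff (\<lambda>x. of_real x ^ m * h x) (Suc m) (node_tuple a b z)) \<le> B"
  shows "norm (\<Sum>(a, b)\<in>P. c (a, b) * ((h a - h b) / of_real (a - b))) \<le> B"
  using bound
proof (induction m)
  case 0
  have "admissible P (Suc 0) (\<lambda>_. 0)" by (simp add: admissible_def)
  from 0[OF this] show ?case by (simp add: node_tuple_def)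
next
  case (Suc m)
  show ?case
  proof (rule Suc.IH)
    fix z assume z: "admissible P (Suc m) z"
    have c: "isCont (\<lambda>x. complex_of_real x ^ m * h x) 0" using h by (intro continuous_intros)
    show "norm (\<Sum>(a, b)\<in>P. c (a, b) * divdiff (\<lambda>x. of_real x ^ m * h x) (Suc m) (node_tuple a b z)) \<le> B"
    proof (rule divdiff_bound_drop_power[OF P _ c _ z])
      have e: "(\<lambda>x. of_real x * (of_real x ^ m * h x)) = (\<lambda>x. of_real x ^ Suc m * h x)"
        by (simp add: mult.assoc)
      show "norm (\<Sum>(a, b)\<in>P. c (a, b) *
          divdiff (\<lambda>x. of_real x * (of_real x ^ m * h x)) (Suc (Suc m)) (node_tuple a b z)) \<le> B"
        if "admissible P (Suc (Suc m)) z" for z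
        unfolding e using that by (rule Suc.prems)
    qed auto
  qed
qed

text \<open>
  The weights \<open>1 / (\<pi> n (i - j))\<close> give a functional bounded by 1 on products of functions bounded
  by 1: the factors \<open>a\<^sub>i(z\<^sub>i)\<close> with \<open>i \<ge> 2\<close> combine to one constant of modulus at most 1, which is
  absorbed into the second factor, and Hilbert's inequality applies. All \<open>x\<^sub>i\<close> are positive, so the
  nodes \<open>x\<^sub>i\<close> and \<open>- x\<^sub>j\<close> never coincide.
\<close>

lemma NCk_hilbert_bounded:
  fixes h :: "real \<Rightarrow> complex" and T :: "'s itself"
  assumes f: "(\<lambda>x. of_real x ^ m * h x) \<in> NCk T (Suc m)"
    and fc: "continuous_on UNIV (\<lambda>x. of_real x ^ m * h x)" and h: "isCont h 0"
  shows "\<exists>C. \<forall>n (x :: nat \<Rightarrow> real). inj_on x {1..n} \<longrightarrow> (\<forall>i\<in>{1..n}. 0 < x i \<and> x i \<le> 1) \<longrightarrow>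
     norm (\<Sum>i\<in>{1..n}. \<Sum>j\<in>{1..n}. (h (x i) - h (- x j)) / of_real (x i + x j) / of_int (int i - int j))
       \<le> C * real n"
proof -
  define C where "C = enn2real (iptp_norm T {..Suc m} (\<lambda>_. restrict_space borel {-1..1})
    (divdiff_ext (\<lambda>x. of_real x ^ m * h x) (Suc m)))"
  show ?thesis
  proof (rule exI[of _ "C * pi"], intro allI impI)
    fix n and x :: "nat \<Rightarrow> real"
    assume inj: "inj_on x {1..n}" and x: "\<forall>i\<in>{1..n}. 0 < x i \<and> x i \<le> 1"
    show "norm (\<Sum>i\<in>{1..n}. \<Sum>j\<in>{1..n}. (h (x i) - h (- x j)) / of_real (x i + x j) / of_int (int i - int j)) \<le> C * pi * n"
    proof (cases "n = 0")
      case False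
      let ?A = "{1..n}"
      define P where "P = (\<lambda>(i, j). (x i, - x j)) ` (?A \<times> ?A)"
      have injP: "inj_on (\<lambda>(i, j). (x i, - x j)) (?A \<times> ?A)"
      proof (rule inj_onI)
        fix p q assume pq: "p \<in> ?A \<times> ?A" "q \<in> ?A \<times> ?A"
          "(\<lambda>(i, j). (x i, - x j)) p = (\<lambda>(i, j). (x i, - x j)) q"
        then have "x (fst p) = x (fst q)" "x (snd p) = x (snd q)" by (simp_all add: case_prod_unfold)
        with pq show "p = q" using inj_onD[OF inj] by (intro prod_eqI) (auto simp: mem_Times_iff)
      qed
      have sumP: "(\<Sum>p\<in>P. F p) = (\<Sum>i\<in>?A. \<Sum>j\<in>?A. F (x i, - x j))" for F :: "real \<times> real \<Rightarrow> complex"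
        unfolding P_def sum.reindex[OF injP] by (simp add: sum.cartesian_product case_prod_unfold)
      \<comment> \<open>The weights have to be functions of the points, so the indices are recovered from them.\<close>
      define y where "y = the_inv_into ?A x"
      have y: "y (x i) = i" if "i \<in> ?A" for i
        unfolding y_def using inj that by (rule the_inv_into_f_f)
      define c where "c = (\<lambda>(a, b). 1 / (of_real (pi * n) * of_int (int (y a) - int (y (- b)))) :: complex)"
      have c: "c (x i, - x j) = 1 / (of_real (pi * n) * of_int (int i - int j))" if "i \<in> ?A" "j \<in> ?A" for i j
        using that by (simp add: c_def y)
      have scale: "norm (S / complex_of_real (pi * n)) \<le> B \<longleftrightarrow> norm S \<le> B * (pi * n)" for S B
        using False by (simp add: norm_divide norm_mult divide_le_eq)
      have sgnP: "0 < a \<and> a \<le> 1 \<and> - 1 \<le> b \<and> b < 0" if "(a, b) \<in> P" for a b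
        using x that unfolding P_def by auto
      have finP: "finite P" by (simp add: P_def)
      have neP: "a \<noteq> b \<and> a \<noteq> 0 \<and> b \<noteq> 0" if "(a, b) \<in> P" for a b
        using sgnP[OF that] by simp
      have P1: "\<bar>a\<bar> \<le> 1 \<and> \<bar>b\<bar> \<le> 1" if "(a, b) \<in> P" for a b
        using sgnP[OF that] by simp
      have "norm (\<Sum>(a, b)\<in>P. c (a, b) * ((h a - h b) / of_real (a - b))) \<le> C"
      proof (rule divdiff_bound_drop_powers[OF finP neP h])
        fix z assume z: "admissible P (Suc m) z"
        define w where "w p = node_tuple (fst p) (snd p) z" for p
        have "norm (\<Sum>p\<in>P. c p * divdiff (\<lambda>x. of_real x ^ m * h x) (Suc m) (w p)) \<le> C"
          unfolding C_def
        proof (rule NCk_divdiff_bounded[OF f fc zero_less_one finP])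
          show "\<bar>w p i\<bar> \<le> 1" if "p \<in> P" "i \<le> Suc m" for p i
            using z that P1[of "fst p" "snd p"] by (auto simp: w_def node_tuple_def admissible_def)
          show "inj_on (w p) {..Suc m}" if "p \<in> P" for p
            unfolding w_def using that neP[of "fst p" "snd p"] by (intro inj_on_node_tuple[OF z]) auto
          fix a :: "nat \<Rightarrow> real \<Rightarrow> complex"
          assume a: "\<And>i x. i \<le> Suc m \<Longrightarrow> norm (a i x) \<le> 1"
          define d where "d = (\<Prod>i\<in>{2..Suc m}. a i (z i))"
          have d: "norm d \<le> 1" unfolding d_def prod_norm[symmetric] using a by (intro prod_le_1) auto
          have s: "{..Suc m} = insert 0 (insert 1 {2..Suc m})" by auto
          have pr: "(\<Prod>i\<le>Suc m. a i (w p i)) = a 0 (fst p) * (a 1 (snd p) * d)" for p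
          proof -
            have "(\<Prod>i\<in>{2..Suc m}. a i (w p i)) = d"
              unfolding d_def by (intro prod.cong) (auto simp: w_def node_tuple_def)
            then show ?thesis unfolding s by (simp add: w_def node_tuple_def)
          qed
          have H: "norm (\<Sum>i\<in>?A. \<Sum>j\<in>?A. a 0 (x i) * (a 1 (- x j) * d) / of_int (int i - int j)) \<le> pi * card ?A"
          proof (rule hilbert_inequality)
            show "norm (a 0 (x i)) \<le> 1" for i using a by simp
            show "norm (a 1 (- x j) * d) \<le> 1" for j
              using a[of 1] d by (simp add: norm_mult mult_le_one)
          qed simp
          have "(\<Sum>p\<in>P. c p * (\<Prod>i\<le>Suc m. a i (w p i)))
              = (\<Sum>i\<in>?A. \<Sum>j\<in>?A. a 0 (x i) * (a 1 (- x j) * d) / of_int (int i - int j)) / of_real (pi * n)"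
            unfolding sumP pr sum_divide_distrib by (intro sum.cong refl) (simp add: c)
          then show "norm (\<Sum>p\<in>P. c p * (\<Prod>i\<le>Suc m. a i (w p i))) \<le> 1"
            using H by (simp only: scale card_atLeastAtMost) simp
        qed
        then show "norm (\<Sum>(a, b)\<in>P. c (a, b) * divdiff (\<lambda>x. of_real x ^ m * h x) (Suc m) (node_tuple a b z)) \<le> C"
          by (simp only: w_def case_prod_unfold prod.collapse)
      qed
      moreover have "(\<Sum>(a, b)\<in>P. c (a, b) * ((h a - h b) / of_real (a - b)))
         = (\<Sum>i\<in>?A. \<Sum>j\<in>?A. (h (x i) - h (- x j)) / of_real (x i + x j) / of_int (int i - int j)) / of_real (pi * n)"
        unfolding case_prod_unfold sumP sum_divide_distrib prod.collapse
        by (intro sum.cong refl) (simp add: c)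
      ultimately show ?thesis by (simp only: scale mult.assoc)
    qed simp
  qed
qed

section \<open>Growth of the Hilbert sums\<close>

text \<open>
  The damping factor \<open>1 / sqrt (ln (1 + i))\<close> decreases in \<open>i\<close>, so the numerator is at least
  \<open>(exp (- i) - exp (- j)) / sqrt (ln (1 + j))\<close>; and \<open>exp (- j) \<le> exp (- i) / 2\<close> gives the factor
  \<open>1/3\<close>.
\<close>

lemma log_damped_hilbert_term:
  fixes i j :: nat
  assumes "1 \<le> i" "i < j"
  defines "H \<equiv> \<lambda>i::nat. exp (- real i) / sqrt (ln (1 + real i))"
  shows "(H i - H j) / (exp (- real i) + exp (- real j)) \<ge> 1 / (3 * sqrt (ln (1 + real j)))"
proof -
  let ?x = "\<lambda>i::nat. exp (- real i)" and ?s = "\<lambda>i::nat. sqrt (ln (1 + real i))"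
  have s: "0 < ?s i" "?s i \<le> ?s j" using assms(1,2) by simp_all
  have "?x j \<le> exp (- real i - 1)" using assms(2) by simp
  also have "\<dots> = ?x i / exp 1" by (simp add: exp_diff)
  also have "\<dots> \<le> ?x i / 2" using exp_ge_add_one_self[of 1] by (intro divide_left_mono) auto
  finally have x: "?x i + ?x j \<le> 3 * (?x i - ?x j)" by simp
  have "(?x i + ?x j) / (3 * ?s j) \<le> (?x i - ?x j) / ?s j"
    using x s by (simp add: field_simps)
  also have "\<dots> \<le> H i - H j"
    unfolding H_def diff_divide_distrib using s by (intro diff_right_mono divide_left_mono) auto
  finally show ?thesis using s by (simp add: field_simps add_pos_pos)
qed

text \<open>
  All terms are nonpositive, as \<open>H i - H j\<close> has the sign of \<open>j - i\<close>. The \<open>N\<^sup>2\<close> terms with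
  \<open>i \<le> N\<close> and \<open>1 \<le> j - i \<le> N\<close> already produce \<open>N\<close> copies of the harmonic sum up to \<open>N\<close>.
\<close>

lemma log_damped_hilbert_sum:
  fixes N :: nat
  defines "H \<equiv> \<lambda>i::nat. exp (- real i) / sqrt (ln (1 + real i))"
  shows "N * ln (N + 1) / (3 * sqrt (ln (1 + 2 * real N)))
     \<le> - (\<Sum>i\<in>{1..2*N}. \<Sum>j\<in>{1..2*N}. (H i - H j) / (exp (- real i) + exp (- real j)) / of_int (int i - int j))"
proof -
  define t where "t i j = - ((H i - H j) / (exp (- real i) + exp (- real j)) / of_int (int i - int j))" for i j :: nat
  define s where "s = sqrt (ln (1 + 2 * real N))"
  have t: "t i j \<ge> 1 / (3 * s) * (1 / real (j - i))" if "1 \<le> i" "i < j" "j \<le> 2 * N" for i j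
  proof -
    have "sqrt (ln (1 + real j)) \<le> s" "0 < sqrt (ln (1 + real j))" using that unfolding s_def by simp_all
    then have "0 < s" by linarith
    with \<open>0 < sqrt (ln (1 + real j))\<close> \<open>sqrt (ln (1 + real j)) \<le> s\<close>
    have "1 / (3 * s) \<le> 1 / (3 * sqrt (ln (1 + real j)))"
      by (intro divide_left_mono mult_left_mono mult_pos_pos) auto
    also have "\<dots> \<le> (H i - H j) / (exp (- real i) + exp (- real j))"
      unfolding H_def by (rule log_damped_hilbert_term[OF that(1,2)])
    finally have "1 / (3 * s) * (1 / real (j - i))
        \<le> (H i - H j) / (exp (- real i) + exp (- real j)) * (1 / real (j - i))"
      by (rule mult_right_mono) simp
    also have "\<dots> = t i j"
    proof -
      have "real_of_int (int i - int j) = - real (j - i)" using that by (simp add: of_nat_diff)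
      then show ?thesis unfolding t_def by (simp only: divide_minus_right minus_minus) simp
    qed
    finally show ?thesis .
  qed
  have s0: "s \<ge> 0" by (simp add: s_def)
  have tsym: "t i j = t j i" for i j
  proof -
    have "x / s / y = (- x) / s / (- y)" for x s y :: real by simp
    from this[of "H i - H j" "exp (- real i) + exp (- real j)" "of_int (int i - int j)"]
    show ?thesis unfolding t_def by (simp add: add.commute)
  qed
  have t0: "t i j \<ge> 0" if "i \<in> {1..2*N}" "j \<in> {1..2*N}" for i j
  proof -
    have le: "0 \<le> t i j" if "1 \<le> i" "i < j" "j \<le> 2 * N" for i j
      by (rule order_trans[OF _ t[OF that]]) (use s0 in simp)
    show ?thesis
    proof (rule linorder_cases[of i j])
      assume "i = j" then show ?thesis by (simp add: t_def)
    qed (use le[of i j] le[of j i] tsym[of i j] that in auto)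
  qed
  have "N * ln (N + 1) / (3 * s) \<le> N * harm N / (3 * s)"
    using ln_le_harm[of N] s0 by (intro divide_right_mono mult_left_mono) (auto simp: add_ac)
  also have "\<dots> = (\<Sum>i\<in>{1..N}. \<Sum>d\<in>{1..N}. 1 / (3 * s) * (1 / real d))"
    by (simp add: harm_def inverse_eq_divide sum_distrib_left sum_divide_distrib mult_ac)
  also have "\<dots> \<le> (\<Sum>i\<in>{1..N}. \<Sum>d\<in>{1..N}. t i (i + d))"
  proof (intro sum_mono)
    fix i d assume "i \<in> {1..N}" "d \<in> {1..N}"
    then show "1 / (3 * s) * (1 / real d) \<le> t i (i + d)" using t[of i "i + d"] by auto
  qed
  also have "\<dots> = (\<Sum>i\<in>{1..N}. \<Sum>j\<in>(+) i ` {1..N}. t i j)"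
    by (simp only: sum.reindex inj_on_add comp_def)
  also have "\<dots> \<le> (\<Sum>i\<in>{1..N}. \<Sum>j\<in>{1..2*N}. t i j)"
    using t0 by (intro sum_mono sum_mono2) auto
  also have "\<dots> \<le> (\<Sum>i\<in>{1..2*N}. \<Sum>j\<in>{1..2*N}. t i j)"
    using t0 by (intro sum_mono2 sum_nonneg) auto
  finally show ?thesis by (simp add: t_def sum_negf s_def)
qed

text \<open>
  By the previous estimate, a bound \<open>C n\<close> would imply \<open>sqrt (ln (N + 1)) \<le> 12 C\<close> for all
  \<open>N \<ge> 1\<close>.
\<close>

lemma log_damped_hilbert_unbounded:
  fixes C :: real
  defines "H \<equiv> \<lambda>i::nat. exp (- real i) / sqrt (ln (1 + real i))"
  shows "\<exists>n. C * n < \<bar>\<Sum>i\<in>{1..n}. \<Sum>j\<in>{1..n}. (H i - H j) / (exp (- real i) + exp (- real j)) / of_int (int i - int j)\<bar>"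
proof (rule ccontr)
  assume "\<not> ?thesis"
  then have C: "\<bar>\<Sum>i\<in>{1..n}. \<Sum>j\<in>{1..n}. (H i - H j) / (exp (- real i) + exp (- real j)) / of_int (int i - int j)\<bar> \<le> C * n" for n
    by (auto simp: not_less)
  obtain N :: nat where N: "exp (144 * C\<^sup>2 + 1) < N" using reals_Archimedean2 by blast
  have N1: "1 \<le> N" using N by (cases N) auto
  define L where "L = ln (real N + 1)"
  have L: "144 * C\<^sup>2 < L" "0 < L"
  proof -
    have "exp (144 * C\<^sup>2 + 1) < real N + 1" using N by simp
    then have "144 * C\<^sup>2 + 1 < L" unfolding L_def by (subst exp_less_cancel_iff[symmetric]) (simp add: add_pos_nonneg)
    then show "144 * C\<^sup>2 < L" by simp
    show "0 < L" using N1 by (simp add: L_def)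
  qed
  have "ln (1 + 2 * real N) \<le> ln ((real N + 1)^2)"
    by (subst ln_le_cancel_iff) (auto simp: power2_eq_square algebra_simps add_pos_nonneg)
  also have "\<dots> = 2 * L" by (simp add: L_def ln_realpow)
  also have "\<dots> \<le> 4 * L" using L by simp
  finally have "sqrt (ln (1 + 2 * real N)) \<le> sqrt (4 * L)" by simp
  then have s: "sqrt (ln (1 + 2 * real N)) \<le> 2 * sqrt L" by (simp add: real_sqrt_mult)
  have s0: "0 < sqrt (ln (1 + 2 * real N))" using N1 by simp
  have "N * L / (3 * sqrt (ln (1 + 2 * real N))) \<le> C * real (2 * N)"
    using log_damped_hilbert_sum[of N] C[of "2 * N"] unfolding H_def L_def by (simp add: add.commute)
  then have "N * L \<le> N * (6 * C * sqrt (ln (1 + 2 * real N)))"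
    using s0 by (simp add: field_simps)
  then have LC: "L \<le> 6 * C * sqrt (ln (1 + 2 * real N))" using N1 by simp
  with L s0 have "0 < C" by (smt (verit) mult_nonpos_nonneg)
  then have "6 * C * sqrt (ln (1 + 2 * real N)) \<le> 6 * C * (2 * sqrt L)" using s by (intro mult_left_mono) auto
  with LC have "L \<le> 12 * C * sqrt L" by simp
  moreover have "L = sqrt L * sqrt L" using L by simp
  ultimately have "sqrt L * sqrt L \<le> 12 * C * sqrt L" by simp
  then have "sqrt L \<le> 12 * C" by (rule mult_right_le_imp_le) (use L in simp)
  then have "(sqrt L)\<^sup>2 \<le> (12 * C)\<^sup>2" using L by (intro power_mono) auto
  then show False using L by (simp add: power_mult_distrib)
qed

section \<open>The strict inclusion\<close>

text \<open>
  The cutoff is 1 at the test points \<open>\<plusminus> exp (- i)\<close> with \<open>i \<ge> 1\<close>, whose moduli are at most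
  \<open>1 / exp 1\<close>.
\<close>

lemma f_fun_notin_NCk:
  assumes k: "k \<ge> 1" and fC: "f_fun \<eta> k \<in> Ck k" and hC: "f_fun \<eta> 1 \<in> Ck 1"
    and \<eta>: "\<And>x. \<bar>x\<bar> \<le> 1 / exp 1 \<Longrightarrow> \<eta> x = 1"
  shows "f_fun \<eta> k \<notin> NCk TYPE('s) k"
proof
  assume f: "f_fun \<eta> k \<in> NCk TYPE('s) k"
  have Ck0: "f \<in> Ck k \<Longrightarrow> f \<in> Ck 0" for f k
  proof (induction k)
    case (Suc k)
    show ?case by (rule Suc.IH[OF Ck_SucD[OF Suc.prems]])
  qed
  obtain m where m: "k = Suc m" using k by (cases k) auto
  have fe: "f_fun \<eta> k = (\<lambda>x. of_real x ^ m * h_fun \<eta> x)" by (simp add: f_fun_def m fun_eq_iff)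
  have fc: "continuous_on UNIV (f_fun \<eta> k)" using Ck0[OF fC] by simp
  have "f_fun \<eta> 1 = h_fun \<eta>" by (simp add: f_fun_def fun_eq_iff)
  then have hc: "isCont (h_fun \<eta>) 0" using Ck0[OF hC] by (simp add: continuous_on_eq_continuous_at)
  obtain C where C: "\<forall>n (x :: nat \<Rightarrow> real). inj_on x {1..n} \<longrightarrow> (\<forall>i\<in>{1..n}. 0 < x i \<and> x i \<le> 1) \<longrightarrow>
     norm (\<Sum>i\<in>{1..n}. \<Sum>j\<in>{1..n}. (h_fun \<eta> (x i) - h_fun \<eta> (- x j)) / of_real (x i + x j) / of_int (int i - int j))
       \<le> C * real n"
    using NCk_hilbert_bounded[OF f[unfolded fe, unfolded m] fc[unfolded fe] hc] by blast
  define H where "H i = exp (- real i) / sqrt (ln (1 + real i))" for i :: nat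
  obtain n where n: "C * n < \<bar>\<Sum>i\<in>{1..n}. \<Sum>j\<in>{1..n}. (H i - H j) / (exp (- real i) + exp (- real j)) / of_int (int i - int j)\<bar>"
    using log_damped_hilbert_unbounded[of C] unfolding H_def by blast
  have h: "h_fun \<eta> (exp (- real i)) = of_real (H i)" "h_fun \<eta> (- exp (- real i)) = of_real (H i)" if "1 \<le> i" for i
  proof -
    have "exp (- real i) \<le> exp (- 1)" using that by simp
    then have "\<eta> (exp (- real i)) = 1" "\<eta> (- exp (- real i)) = 1"
      by (auto intro!: \<eta> simp: exp_minus inverse_eq_divide)
    then show "h_fun \<eta> (exp (- real i)) = of_real (H i)" "h_fun \<eta> (- exp (- real i)) = of_real (H i)"
      using that by (simp_all add: h_fun_def H_def indicator_def add_ac)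
  qed
  have "norm (\<Sum>i\<in>{1..n}. \<Sum>j\<in>{1..n}. (h_fun \<eta> (exp (- real i)) - h_fun \<eta> (- exp (- real j)))
      / of_real (exp (- real i) + exp (- real j)) / of_int (int i - int j)) \<le> C * n"
    by (intro C[rule_format]) (simp_all add: inj_on_def)
  also have "(\<Sum>i\<in>{1..n}. \<Sum>j\<in>{1..n}. (h_fun \<eta> (exp (- real i)) - h_fun \<eta> (- exp (- real j)))
      / of_real (exp (- real i) + exp (- real j)) / of_int (int i - int j))
     = of_real (\<Sum>i\<in>{1..n}. \<Sum>j\<in>{1..n}. (H i - H j) / (exp (- real i) + exp (- real j)) / of_int (int i - int j))"
    unfolding of_real_sum by (intro sum.cong refl) (simp add: h)
  finally show False using n by (simp only: norm_of_real)
qed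

theorem theorem4p4p1:
  fixes k :: nat
  assumes "k \<ge> 1"
  shows "NCk TYPE('s) k \<subset> Ck k \<and>
    (\<forall>\<eta>. \<eta> \<in> Cc_infinity \<longrightarrow>
      (\<forall>x \<in> {- (1/2) - 1 / exp 1 .. 1 / exp 1 + 1/2}. \<eta> x = 1) \<longrightarrow>
      closure {x. \<eta> x \<noteq> 0} \<subseteq> {- (3/5) - 1 / exp 1 .. 1 / exp 1 + 3/5} \<longrightarrow>
      f_fun \<eta> k \<in> Ck k - NCk TYPE('s) k)"
proof (intro conjI allI impI)
  have main: "f_fun \<eta> k \<in> Ck k - NCk TYPE('s) k"
    if \<eta>: "\<eta> \<in> Ck k" "c < 1" "\<And>x. \<bar>x\<bar> > c \<Longrightarrow> \<eta> x = 0" "\<And>x. \<bar>x\<bar> \<le> 1 / exp 1 \<Longrightarrow> \<eta> x = 1" for \<eta> c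
  proof -
    have lower: "\<eta> \<in> Ck (Suc m) \<Longrightarrow> \<eta> \<in> Ck 1" for m
    proof (induction m)
      case (Suc m)
      show ?case by (rule Suc.IH[OF Ck_SucD[OF Suc.prems]])
    qed simp
    have "\<eta> \<in> Ck (Suc (k - 1))" using assms \<eta>(1) by (simp only: Suc_diff_1)
    then have "\<eta> \<in> Ck 1" by (rule lower)
    from f_fun_Ck[OF order_refl \<eta>(2,3) this] have 1: "f_fun \<eta> 1 \<in> Ck 1" by blast
    from f_fun_Ck[OF assms \<eta>(2,3,1)] have fk: "f_fun \<eta> k \<in> Ck k" by blast
    show ?thesis using fk f_fun_notin_NCk[OF assms fk 1 \<eta>(4)] by blast
  qed
  show "NCk TYPE('s) k \<subset> Ck k"
  proof -
    obtain \<eta> where \<eta>: "\<eta> \<in> Ck k" "\<And>x. \<bar>x\<bar> \<le> 1/2 \<Longrightarrow> \<eta> x = 1" "\<And>x. \<bar>x\<bar> > 9/10 \<Longrightarrow> \<eta> x = 0"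
      using exists_Ck_cutoff by blast
    have "1 / exp 1 \<le> 1 / (2 :: real)"
      using exp_ge_add_one_self[of 1] by (intro divide_left_mono) auto
    then have "f_fun \<eta> k \<in> Ck k - NCk TYPE('s) k"
      by (intro main[where c="9/10", OF \<eta>(1) _ \<eta>(3)] \<eta>(2)) linarith+
    moreover have "NCk TYPE('s) k \<subseteq> Ck k" by (auto simp: NCk_def)
    ultimately show ?thesis by blast
  qed
  fix \<eta> assume \<eta>: "\<eta> \<in> Cc_infinity" "\<forall>x \<in> {- (1/2) - 1 / exp 1 .. 1 / exp 1 + 1/2}. \<eta> x = 1"
    "closure {x. \<eta> x \<noteq> 0} \<subseteq> {- (3/5) - 1 / exp 1 .. 1 / exp 1 + 3/5}"
  show "f_fun \<eta> k \<in> Ck k - NCk TYPE('s) k"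
  proof (rule main)
    show "\<eta> \<in> Ck k" using \<eta>(1) by (auto simp: Cc_infinity_def)
    \<comment> \<open>The support of \<open>\<eta>\<close> stays inside \<open>\<bar>x\<bar> < 1\<close> because \<open>1/e + 3/5 < 1\<close>, which amounts to \<open>e > 5/2\<close>.\<close>
    have "(13/8)^2 \<le> exp (1/2 :: real)^2"
    proof (rule power_mono)
      have "1 + 1/2 + (1/2)\<^sup>2 / 2 \<le> exp (1/2 :: real)" by (rule exp_lower_Taylor_quadratic) simp
      then show "13/8 \<le> exp (1/2 :: real)" by (simp add: power2_eq_square)
    qed simp
    also have "exp (1/2 :: real)^2 = exp 1" by (simp add: exp_double[symmetric])
    finally have "5/2 < exp (1::real)" by (simp add: power2_eq_square)
    then have "1 / exp 1 < 1 / (5/2 :: real)" by (intro divide_strict_left_mono) auto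
    then show "1 / exp 1 + 3/5 < (1::real)" by simp
    show "\<eta> x = 0" if "\<bar>x\<bar> > 1 / exp 1 + 3/5" for x
    proof (rule ccontr)
      assume "\<eta> x \<noteq> 0"
      then have "x \<in> closure {x. \<eta> x \<noteq> 0}" using closure_subset[of "{x. \<eta> x \<noteq> 0}"] by auto
      with \<eta>(3) have "x \<in> {- (3/5) - 1 / exp 1 .. 1 / exp 1 + 3/5}" by (rule subsetD)
      then show False using that by auto
    qed
    show "\<eta> x = 1" if "\<bar>x\<bar> \<le> 1 / exp 1" for x
    proof -
      have "x \<in> {- (1/2) - 1 / exp 1 .. 1 / exp 1 + 1/2}" using that by auto
      then show ?thesis using \<eta>(2) by blast
    qed
  qed
qed

end
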